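(* Let $P:\subseteq\mathbb{N}^{\mathbb{N}}\rightrightarrows\mathbb{N}^{\mathbb{N}}$ be a problem, let $p\in\mathrm{dom}(P)$, and let $\alpha$ be a countable ordinal. The following are equivalent. 1. There is a set $A\subseteq\mathbb{N}^{\mathbb{N}}$ such that $P|_A$ is discontinuous, $p$ is a point of discontinuity of $P|_A$, and $\mathrm{rank}_A(p)\le\alpha$. 2. $\mathsf{ACC}_{\mathbb{N}}^{\alpha}\le_{\mathrm{W}}^{*}P$ via some forward function $\Phi$ such that $\Phi(\#^{\mathbb{N}})=p$. 3. Player 1 has a winning strategy in the rank-$\alpha$ discontinuity game for $P$ with initial move $p$. 4. $p$ is a rank-$\beta$ discontinuity of $P$ for some $\beta\le\alpha$.
   Context: **Problems.** $\mathbb{N}^{\mathbb{N}}$ is Baire space; for a finite string $\sigma\in\mathbb{N}^{<\mathbb{N}}$, $\sigma\sqsubseteq x$ means $\sigma$ is an initial segment of $x$, and $[\![\sigma]\!]=\{x\in\mathbb{N}^{\mathbb{N}}:\sigma\sqsubseteq x\}$. A problem $P:\subseteq\mathbb{N}^{\mathbb{N}}\rightrightarrows\mathbb{N}^{\mathbb{N}}$ is a partial multivalued function: a set $\mathrm{dom}(P)$ of instances and, for each $p\in\mathrm{dom}(P)$, a set $P(p)\subseteq\mathbb{N}^{\mathbb{N}}$ of solutions; $P(p)=\emptyset$ is allowed. $P|_A$ has domain $\mathrm{dom}(P)\cap A$ and the same solution sets. $P|[A\times B]$ has domain $\mathrm{dom}(P)\cap A$ and $P|[A\times B](x)=P(x)\cap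 B$ (possibly empty). $P$ is continuous if there is a continuous partial function $\Phi$ defined on $\mathrm{dom}(P)$ with $\Phi(p)\in P(p)$ for all $p\in\mathrm{dom}(P)$; otherwise it is discontinuous. $p\in\mathrm{dom}(P)$ is a (point of) discontinuity of $P$ if there is no open neighborhood $U$ of $p$ with $P|_U$ continuous. **Continuous Weihrauch reducibility.** $P\le_{\mathrm{W}}^{*}Q$ via forward function $\Phi$ and backward function $\Psi$ if these are continuous partial functions such that for all $p\in\mathrm{dom}(P)$, $\Phi(p)$ is defined and in $\mathrm{dom}(Q)$, and for all $\hat q\in Q(\Phi(p))$, $\Psi(p,\hat q)$ is defined and in $P(p)$. **Rank.** For $p\in A\subseteq\mathbb{N}^{\mathbb{N}}$, $\mathrm{rank}_A(p)$ is the Cantor–Bendixson rank: the ordinal $\alpha$ with $p\in A^{(\alpha)}\setminus A^{(\alpha+1)}$ (iterated Cantor–Bendixson derivatives; isolated points have rank $0$), or $\infty$ if there is none. **$\mathsf{ACC}_{\mathbb{N}}^{\alpha}$.** For $\beta>0$, $\ell_\beta:\mathbb{N}\to\beta$ is rank-witnessing for $\beta$ if it is nondecreasing and for each $\gamma<\beta$ there is $i$ with $\ell_\beta(i)\ge\gamma$. A rank-witnessing representation of $\alpha$ is a family $\{\ell_\beta:0<\beta\le\alpha\}$ with each $\ell_\beta$ rank-witnessing for $\beta$. Fix one. Identify $(\mathbb{N}\cup\{\#\})^{\mathbb{N}}$ with $\mathbb{N}^{\mathbb{N}}$ via $\#\mapsto0$, $n\mapsto n+1$. Define recursively: - $\mathrm{dom}(\mathsf{ACC}_{\mathbb{N}}^{0})=\{\#^{\mathbb{N}}\}$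 and $\mathsf{ACC}_{\mathbb{N}}^{0}(\#^{\mathbb{N}})=\emptyset$. - For $\alpha>0$: $\mathrm{dom}(\mathsf{ACC}_{\mathbb{N}}^{\alpha})=\{\#^{\mathbb{N}}\}\cup\{\#^{j}nw: j,n\in\mathbb{N},\ w\in\mathrm{dom}(\mathsf{ACC}_{\mathbb{N}}^{\ell_\alpha(j)})\}$; $\mathsf{ACC}_{\mathbb{N}}^{\alpha}(\#^{\mathbb{N}})=\{mq:m\in\mathbb{N},q\in(\mathbb{N}\cup\{\#\})^{\mathbb{N}}\}$; and $\mathsf{ACC}_{\mathbb{N}}^{\alpha}(\#^{j}nw)=\{mq:m\in\mathbb{N},m\ne n,q\in(\mathbb{N}\cup\{\#\})^{\mathbb{N}}\}\cup\{n\#^{k}y:k\in\mathbb{N},y\in\mathsf{ACC}_{\mathbb{N}}^{\ell_\alpha(j)}(w)\}$. **Rank-$\alpha$ discontinuity game for $P$** (recursive definition, $\alpha$ countable). Step 1: Player 1 plays $p\in\mathrm{dom}(P)$. Step 2: if $P(p)=\emptyset$, Player 1 wins and the game ends; otherwise Player 2 plays $q\in P(p)$. Step 3: if $\alpha=0$ (and Player 1 has not already won), Player 2 wins and the game ends; otherwise Player 1 plays a finite $\rho\sqsubseteq q$. Step 4: Player 2 plays a finite $\sigma\sqsubseteq p$. Step 5: Player 1 chooses $\gamma<\alpha$ and the players play the rank-$\gamma$ discontinuity game for $P|[[\![\sigma]\!]\times[\![\rho]\!]]$; its winner wins. **Rank of discontinuity.** Let $p\in\mathrm{dom}(P)$ be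 a discontinuity of $P$. If $P(p)=\emptyset$, $p$ is a rank-$0$ discontinuity of $P$. For countable $\alpha>0$, (when $P(p)\ne\emptyset$) $p$ is a rank-$\alpha$ discontinuity of $P$ if $\alpha$ is the least ordinal such that for all $q\in P(p)$ there is a finite $\rho\sqsubseteq q$ such that for all finite $\sigma\sqsubseteq p$ there is $p'\in\mathrm{dom}(P)\cap[\![\sigma]\!]$ with $p'\ne p$ such that $p'$ is a rank-$\beta$ discontinuity of $P|[[\![\sigma]\!]\times[\![\rho]\!]]$ for some $\beta<\alpha$. If there is no such $\alpha$, $p$ is a rank-$\infty$ discontinuity. *)

theory Defs
  imports
    "HOL-Analysis.Analysis"
    "HOL-Library.Omega_Words_Fun"
    "HOL-Library.Extended"
begin

section \<open>Countable ordinals\<close>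

text \<open>
  The countable ordinals are the elements of the first uncountable ordinal, which is obtained as
  the cardinal successor of \<open>natLeq\<close>.  The lemmas \<open>countable_lessThan_omega1\<close> and
  \<open>uncountable_omega1\<close> below characterise this well-order up to isomorphism.
\<close>

lemma Well_order_cardSuc_natLeq: "Well_order (cardSuc natLeq)"
  using cardSuc_Card_order[OF natLeq_Card_order] card_order_on_well_order_on by blast

lemma infinite_Field_cardSuc_natLeq: "infinite (Field (cardSuc natLeq))"
  using cardSuc_finite[OF natLeq_Card_order] by (simp add: Field_natLeq)

typedef omega1 = "Field (cardSuc natLeq)"
  using infinite_Field_cardSuc_natLeq by (metis ex_in_conv finite.emptyI)

instantiation omega1 :: wellorder
begin

definition less_eq_omega1 :: "omega1 \<Rightarrow> omega1 \<Rightarrow> bool"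
  where "(x :: omega1) \<le> y \<longleftrightarrow> (Rep_omega1 x, Rep_omega1 y) \<in> cardSuc natLeq"

definition less_omega1 :: "omega1 \<Rightarrow> omega1 \<Rightarrow> bool"
  where "(x :: omega1) < y \<longleftrightarrow> x \<le> y \<and> \<not> y \<le> x"

instance
proof
  let ?r = "cardSuc natLeq"
  have lin: "refl_on (Field ?r) ?r" "trans ?r" "antisym ?r" "total_on (Field ?r) ?r"
    and wf: "wf (?r - Id)"
    using Well_order_cardSuc_natLeq
    by (auto simp: well_order_on_def linear_order_on_def partial_order_on_def preorder_on_def)
  fix x y z :: omega1
  show "x < y \<longleftrightarrow> x \<le> y \<and> \<not> y \<le> x"
    by (simp add: less_omega1_def)
  show refl: "x \<le> x" for x :: omega1
    using lin(1) Rep_omega1 by (auto simp: less_eq_omega1_def refl_on_def)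
  show "x \<le> y \<Longrightarrow> y \<le> z \<Longrightarrow> x \<le> z"
    using lin(2) by (auto simp: less_eq_omega1_def dest: transD)
  show antisym: "x \<le> y \<Longrightarrow> y \<le> x \<Longrightarrow> x = y" for x y :: omega1
    using lin(3) by (auto simp: less_eq_omega1_def Rep_omega1_inject dest: antisymD)
  show "x \<le> y \<or> y \<le> x"
    using lin(4) refl Rep_omega1 unfolding total_on_def less_eq_omega1_def
    by (metis Rep_omega1_inject)
  fix Q :: "omega1 \<Rightarrow> bool" and a
  assume step: "\<And>x. (\<And>y. y < x \<Longrightarrow> Q y) \<Longrightarrow> Q x"
  have "wf (inv_image (?r - Id) Rep_omega1)"
    using wf by (rule wf_inv_image)
  then show "Q a"
  proof (induction a)
    case (less x)
    show ?case
    proof (rule step)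
      fix y assume "y < x"
      then have "(y, x) \<in> inv_image (?r - Id) Rep_omega1"
        using refl by (auto simp: less_omega1_def less_eq_omega1_def Rep_omega1_inject)
      then show "Q y" by (rule less)
    qed
  qed
qed

end

instantiation omega1 :: zero
begin
definition zero_omega1 :: omega1 where "(0 :: omega1) = (LEAST \<alpha>. True)"
instance ..
end

lemma zero_le_omega1 [simp]: "0 \<le> (\<alpha> :: omega1)"
  unfolding zero_omega1_def by (rule Least_le) simp

lemma not_less_zero_omega1 [simp]: "\<not> (\<alpha> :: omega1) < 0"
  by (simp add: leD)

lemma zero_less_omega1_iff: "0 < (\<alpha> :: omega1) \<longleftrightarrow> \<alpha> \<noteq> 0"
  using zero_le_omega1 order_le_less by blast

lemma countable_lessThan_omega1:
  includes cardinal_syntax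
  shows "countable {..<\<alpha> :: omega1}"
proof -
  let ?r = "cardSuc natLeq"
  have "|underS ?r (Rep_omega1 \<alpha>)| <o ?r"
    using cardSuc_Card_order[OF natLeq_Card_order] Rep_omega1 by (rule card_of_underS)
  then have "|underS ?r (Rep_omega1 \<alpha>)| \<le>o natLeq"
    using cardSuc_ordLeq_ordLess[OF natLeq_Card_order card_of_Card_order] by blast
  then have "|underS ?r (Rep_omega1 \<alpha>)| \<le>o |UNIV :: nat set|"
    using card_of_nat ordIso_symmetric ordLeq_ordIso_trans by blast
  then have "countable (underS ?r (Rep_omega1 \<alpha>))"
    by (auto simp: countable_def card_of_ordLeq[symmetric])
  moreover have "Rep_omega1 ` {..<\<alpha>} \<subseteq> underS ?r (Rep_omega1 \<alpha>)"
    by (auto simp: underS_def less_omega1_def less_eq_omega1_def Rep_omega1_inject)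
  ultimately have "countable (Rep_omega1 ` {..<\<alpha>})"
    by (rule countable_subset[rotated])
  then show ?thesis
    by (rule countable_image_inj_on) (simp add: inj_on_def Rep_omega1_inject)
qed

lemma uncountable_omega1:
  includes cardinal_syntax
  shows "uncountable (UNIV :: omega1 set)"
proof
  let ?r = "cardSuc natLeq"
  assume "countable (UNIV :: omega1 set)"
  then have "countable (Rep_omega1 ` UNIV)" by (rule countable_image)
  then have "countable (Field ?r)"
    using type_definition.Rep_range[OF type_definition_omega1] by simp
  then have "|Field ?r| \<le>o |UNIV :: nat set|"
    by (auto simp: countable_def card_of_ordLeq[symmetric])
  then have "?r \<le>o natLeq"
    using card_of_Field_ordIso[OF cardSuc_Card_order[OF natLeq_Card_order]] card_of_nat
      ordIso_symmetric ordIso_ordLeq_trans ordLeq_ordIso_trans by blast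
  then show False
    using cardSuc_greater[OF natLeq_Card_order] not_ordLess_ordLeq by blast
qed

definition osuc :: "omega1 \<Rightarrow> omega1"
  where "osuc \<alpha> = (LEAST \<beta>. \<alpha> < \<beta>)"

lemma ex_greater_omega1: "\<exists>\<beta>. \<alpha> < (\<beta> :: omega1)"
proof (rule ccontr)
  assume "\<nexists>\<beta>. \<alpha> < \<beta>"
  then have "(UNIV :: omega1 set) \<subseteq> insert \<alpha> {..<\<alpha>}"
    by (auto simp: not_less le_less)
  then have "countable (UNIV :: omega1 set)"
    by (rule countable_subset) (simp add: countable_lessThan_omega1)
  then show False using uncountable_omega1 by blast
qed

lemma less_osuc [simp]: "\<alpha> < osuc \<alpha>"
  unfolding osuc_def using ex_greater_omega1 by (rule LeastI_ex)

lemma less_osuc_iff: "\<beta> < osuc \<alpha> \<longleftrightarrow> \<beta> \<le> \<alpha>"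
proof
  show "\<beta> < osuc \<alpha> \<Longrightarrow> \<beta> \<le> \<alpha>"
    unfolding osuc_def using not_less_Least not_less by blast
qed (use less_osuc le_less_trans in blast)


section \<open>Baire space and problems\<close>

text \<open>
  The library topology on \<open>nat \<Rightarrow> nat\<close> is the product topology with \<open>nat\<close> discrete.
  In a problem \<open>P\<close>, \<open>dom P\<close> is the set of instances and \<open>P p = Some S\<close> says that \<open>S\<close>, possibly
  empty, is the set of solutions of \<open>p\<close>; the restriction of \<open>P\<close> to \<open>A\<close> is \<open>P |` A\<close>.
  Partial functions are likewise maps.
\<close>

type_synonym baire = "nat \<Rightarrow> nat"
type_synonym problem = "baire \<rightharpoonup> baire set"

definition initial_segment :: "nat list \<Rightarrow> baire \<Rightarrow> bool"  (infix \<open>\<sqsubseteq>\<close> 50)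
  where "\<sigma> \<sqsubseteq> x \<longleftrightarrow> (\<exists>y. x = \<sigma> \<frown> y)"

definition cylinder :: "nat list \<Rightarrow> baire set"
  where "cylinder \<sigma> = {x. \<sigma> \<sqsubseteq> x}"

definition restrict_problem :: "problem \<Rightarrow> baire set \<Rightarrow> baire set \<Rightarrow> problem"
  where "restrict_problem P A B = (\<lambda>x. map_option (\<lambda>S. S \<inter> B) ((P |` A) x))"

definition continuous_partial ::
    "('a::topological_space \<rightharpoonup> 'b::topological_space) \<Rightarrow> bool"
  where "continuous_partial \<Phi> \<longleftrightarrow> continuous_on (dom \<Phi>) (\<lambda>x. the (\<Phi> x))"

definition continuous_problem :: "problem \<Rightarrow> bool"
  where "continuous_problem P \<longleftrightarrow>
    (\<exists>\<Phi> :: baire \<rightharpoonup> baire. continuous_partial \<Phi> \<and>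
      (\<forall>p \<in> dom P. \<exists>q \<in> the (P p). \<Phi> p = Some q))"

definition discontinuity :: "problem \<Rightarrow> baire \<Rightarrow> bool"
  where "discontinuity P p \<longleftrightarrow>
    p \<in> dom P \<and> \<not> (\<exists>U. open U \<and> p \<in> U \<and> continuous_problem (P |` U))"

definition weihrauch_via ::
    "problem \<Rightarrow> problem \<Rightarrow> (baire \<rightharpoonup> baire) \<Rightarrow> (baire \<times> baire \<rightharpoonup> baire) \<Rightarrow> bool"
  where "weihrauch_via P Q \<Phi> \<Psi> \<longleftrightarrow>
    continuous_partial \<Phi> \<and> continuous_partial \<Psi> \<and>
    (\<forall>p \<in> dom P. \<exists>x \<in> dom Q. \<Phi> p = Some x \<and>
      (\<forall>q \<in> the (Q x). \<exists>y \<in> the (P p). \<Psi> (p, q) = Some y))"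


section \<open>Cantor--Bendixson rank\<close>

definition cb_derivative :: "baire set \<Rightarrow> baire set"
  where "cb_derivative A = {p \<in> A. p islimpt A}"

text \<open>
  A uniform version of the transfinite iteration; the zero, successor and limit
  equations are \<open>cb_iterate_0\<close>, \<open>cb_iterate_osuc\<close> and \<open>cb_iterate_limit\<close>.
\<close>

function cb_iterate :: "baire set \<Rightarrow> omega1 \<Rightarrow> baire set"
  where "cb_iterate A \<alpha> = A \<inter> (\<Inter>\<beta>\<in>{..<\<alpha>}. cb_derivative (cb_iterate A \<beta>))"
  by pat_completeness auto
termination
  by (relation "inv_image {(x, y). x < y} snd") (auto intro!: wf)

declare cb_iterate.simps [simp del]

lemma cb_iterate_0: "cb_iterate A 0 = A"
  by (subst cb_iterate.simps) auto

lemma cb_derivative_subset: "cb_derivative A \<subseteq> A"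
  by (auto simp: cb_derivative_def)

lemma cb_iterate_antimono: "\<beta> \<le> \<alpha> \<Longrightarrow> cb_iterate A \<alpha> \<subseteq> cb_iterate A \<beta>"
  by (subst (1 2) cb_iterate.simps) fastforce

lemma cb_iterate_osuc: "cb_iterate A (osuc \<alpha>) = cb_derivative (cb_iterate A \<alpha>)"
proof
  show "cb_iterate A (osuc \<alpha>) \<subseteq> cb_derivative (cb_iterate A \<alpha>)"
    by (subst cb_iterate.simps) auto
  have "cb_derivative (cb_iterate A \<alpha>) \<subseteq> cb_derivative (cb_iterate A \<beta>)" if "\<beta> \<le> \<alpha>" for \<beta>
    using cb_iterate_antimono[OF that] by (auto simp: cb_derivative_def intro: islimpt_subset)
  moreover have "cb_derivative (cb_iterate A \<alpha>) \<subseteq> A"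
    using cb_derivative_subset cb_iterate_antimono[OF zero_le_omega1] cb_iterate_0 by blast
  ultimately show "cb_derivative (cb_iterate A \<alpha>) \<subseteq> cb_iterate A (osuc \<alpha>)"
    unfolding cb_iterate.simps[of A "osuc \<alpha>"]
    by (intro Int_greatest INT_greatest) (simp_all add: less_osuc_iff)
qed

lemma cb_iterate_limit:
  assumes "\<delta> \<noteq> 0" and "\<And>\<beta>. \<beta> < \<delta> \<Longrightarrow> osuc \<beta> < \<delta>"
  shows "cb_iterate A \<delta> = (\<Inter>\<beta>\<in>{..<\<delta>}. cb_iterate A \<beta>)"
proof
  show "cb_iterate A \<delta> \<subseteq> (\<Inter>\<beta>\<in>{..<\<delta>}. cb_iterate A \<beta>)"
    by (rule INT_greatest) (simp add: cb_iterate_antimono less_imp_le)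
  show "(\<Inter>\<beta>\<in>{..<\<delta>}. cb_iterate A \<beta>) \<subseteq> cb_iterate A \<delta>"
  proof
    fix x assume x: "x \<in> (\<Inter>\<beta>\<in>{..<\<delta>}. cb_iterate A \<beta>)"
    have "x \<in> A"
      using x assms(1) by (auto simp: zero_less_omega1_iff cb_iterate_0 dest: bspec[of _ _ 0])
    moreover have "x \<in> cb_derivative (cb_iterate A \<beta>)" if "\<beta> < \<delta>" for \<beta>
      using x assms(2)[OF that] by (auto simp: cb_iterate_osuc[symmetric])
    ultimately show "x \<in> cb_iterate A \<delta>"
      by (subst cb_iterate.simps) auto
  qed
qed

text \<open>
  Restricting to countable ordinals loses nothing: Baire space is second countable, so the
  iteration is stationary from some countable stage on, and a point with no
  countable rank has rank \<open>Pinf\<close>.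
\<close>

definition cb_rank :: "baire set \<Rightarrow> baire \<Rightarrow> omega1 extended"
  where "cb_rank A p =
    (if \<exists>\<alpha>. p \<in> cb_iterate A \<alpha> - cb_iterate A (osuc \<alpha>)
     then Fin (THE \<alpha>. p \<in> cb_iterate A \<alpha> - cb_iterate A (osuc \<alpha>)) else Pinf)"


section \<open>The problems \<open>ACC\<close>\<close>

definition rank_witnessing :: "omega1 \<Rightarrow> (nat \<Rightarrow> omega1) \<Rightarrow> bool"
  where "rank_witnessing \<beta> l \<longleftrightarrow>
    (\<forall>i. l i < \<beta>) \<and> mono l \<and> (\<forall>\<gamma><\<beta>. \<exists>i. \<gamma> \<le> l i)"

text \<open>The values of \<open>L\<close> outside \<open>{\<beta>. 0 < \<beta> \<and> \<beta> \<le> \<alpha>}\<close> are irrelevant.\<close>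

definition rank_witnessing_representation :: "omega1 \<Rightarrow> (omega1 \<Rightarrow> nat \<Rightarrow> omega1) \<Rightarrow> bool"
  where "rank_witnessing_representation \<alpha> L \<longleftrightarrow>
    (\<forall>\<beta>. 0 < \<beta> \<and> \<beta> \<le> \<alpha> \<longrightarrow> rank_witnessing \<beta> (L \<beta>))"

lemma ex_rank_witnessing:
  assumes "0 < \<beta>"
  shows "\<exists>l. rank_witnessing \<beta> l"
proof -
  let ?e = "from_nat_into {..<\<beta>}"
  define l where "l = (\<lambda>i. Max (?e ` {..i}))"
  have ne: "{..<\<beta>} \<noteq> {}" using assms by auto
  have e: "?e i < \<beta>" for i using from_nat_into[OF ne] by simp
  have "l i < \<beta>" for i unfolding l_def using e by (subst Max_less_iff) auto
  moreover have "mono l" unfolding l_def by (intro monoI Max_mono) auto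
  moreover have "\<exists>i. \<gamma> \<le> l i" if lt: "\<gamma> < \<beta>" for \<gamma>
  proof -
    obtain i where "?e i = \<gamma>"
      using from_nat_into_surj[OF countable_lessThan_omega1, of \<gamma> \<beta>] lt by auto
    then have "\<gamma> \<le> l i" unfolding l_def by (intro Max_ge) auto
    then show ?thesis ..
  qed
  ultimately show ?thesis unfolding rank_witnessing_def by blast
qed

text \<open>
  Letters of the alphabet with the additional symbol hash are coded as natural numbers: hash is
  \<open>0\<close> and the number \<open>n\<close> is \<open>Suc n\<close>.
\<close>

abbreviation hash :: nat
  where "hash \<equiv> 0"

definition hash_omega :: baire
  where "hash_omega = (\<lambda>_. hash)"

definition hashes_num :: "nat \<Rightarrow> nat \<Rightarrow> nat list"
  where "hashes_num j n = replicate j hash @ [Suc n]"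

definition num_hashes :: "nat \<Rightarrow> nat \<Rightarrow> nat list"
  where "num_hashes n k = Suc n # replicate k hash"

text \<open>
  Least fixed points are used so that the definition makes sense for arbitrary \<open>L\<close>; for a
  rank-witnessing representation the recursion is well-founded, and \<open>ACC\<close> is determined by the
  recursion equations \<open>ACC_0\<close>, \<open>dom_ACC\<close>, \<open>ACC_hash_omega\<close> and \<open>ACC_hashes_num\<close>.
\<close>

inductive acc_instance :: "(omega1 \<Rightarrow> nat \<Rightarrow> omega1) \<Rightarrow> omega1 \<Rightarrow> baire \<Rightarrow> bool"
  for L :: "omega1 \<Rightarrow> nat \<Rightarrow> omega1"
  where
    "acc_instance L \<alpha> hash_omega"
  | "0 < \<alpha> \<Longrightarrow> acc_instance L (L \<alpha> j) w \<Longrightarrow> acc_instance L \<alpha> (hashes_num j n \<frown> w)"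

inductive acc_solution :: "(omega1 \<Rightarrow> nat \<Rightarrow> omega1) \<Rightarrow> omega1 \<Rightarrow> baire \<Rightarrow> baire \<Rightarrow> bool"
  for L :: "omega1 \<Rightarrow> nat \<Rightarrow> omega1"
  where
    "0 < \<alpha> \<Longrightarrow> acc_solution L \<alpha> hash_omega (Suc m ## q)"
  | "0 < \<alpha> \<Longrightarrow> acc_instance L (L \<alpha> j) w \<Longrightarrow> m \<noteq> n \<Longrightarrow>
      acc_solution L \<alpha> (hashes_num j n \<frown> w) (Suc m ## q)"
  | "0 < \<alpha> \<Longrightarrow> acc_instance L (L \<alpha> j) w \<Longrightarrow> acc_solution L (L \<alpha> j) w y \<Longrightarrow>
      acc_solution L \<alpha> (hashes_num j n \<frown> w) (num_hashes n k \<frown> y)"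

definition ACC :: "(omega1 \<Rightarrow> nat \<Rightarrow> omega1) \<Rightarrow> omega1 \<Rightarrow> problem"
  where "ACC L \<alpha> =
    (\<lambda>x. if acc_instance L \<alpha> x then Some {y. acc_solution L \<alpha> x y} else None)"

lemma hashes_num_neq [simp]: "hashes_num j n \<frown> w \<noteq> hash_omega" "hash_omega \<noteq> hashes_num j n \<frown> w"
proof -
  have "(hashes_num j n \<frown> w) j \<noteq> hash_omega j"
    by (simp add: hashes_num_def hash_omega_def conc_def nth_append)
  then show "hashes_num j n \<frown> w \<noteq> hash_omega" "hash_omega \<noteq> hashes_num j n \<frown> w" by metis+
qed

lemma hashes_num_inject [simp]:
  "hashes_num j n \<frown> w = hashes_num j' n' \<frown> w' \<longleftrightarrow> j = j' \<and> n = n' \<and> w = w'"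
proof
  assume eq: "hashes_num j n \<frown> w = hashes_num j' n' \<frown> w'"
  have at: "(hashes_num j n \<frown> w) i = (if i < j then hash else if i = j then Suc n else w (i - Suc j))"
    for i j n w
    by (auto simp: hashes_num_def conc_def nth_append)
  have "j = j'"
    using fun_cong[OF eq, of j] fun_cong[OF eq, of j'] unfolding at
    by (auto split: if_splits)
  moreover have "n = n'"
    using fun_cong[OF eq, of j] calculation unfolding at by simp
  moreover have "w = w'"
  proof
    show "w i = w' i" for i
      using fun_cong[OF eq, of "i + Suc j"] \<open>j = j'\<close> unfolding at by simp
  qed
  ultimately show "j = j' \<and> n = n' \<and> w = w'" by simp
qed simp

lemma ACC_0: "ACC L 0 = [hash_omega \<mapsto> {}]"
  by (rule ext) (auto simp: ACC_def acc_instance.simps[of _ 0] acc_solution.simps[of _ 0])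

lemma dom_ACC:
  assumes "0 < \<alpha>"
  shows "dom (ACC L \<alpha>) =
    {hash_omega} \<union> {hashes_num j n \<frown> w | j n w. w \<in> dom (ACC L (L \<alpha> j))}"
  using assms by (auto simp: ACC_def dom_def acc_instance.simps[of _ \<alpha>])

lemma ACC_hash_omega:
  assumes "0 < \<alpha>"
  shows "ACC L \<alpha> hash_omega = Some {Suc m ## q | m q. True}"
  using assms
  by (auto simp: ACC_def acc_instance.simps[of _ \<alpha>] acc_solution.simps[of _ \<alpha> hash_omega])

lemma ACC_hashes_num:
  assumes "0 < \<alpha>" "w \<in> dom (ACC L (L \<alpha> j))"
  shows "ACC L \<alpha> (hashes_num j n \<frown> w) = Some
    ({Suc m ## q | m q. m \<noteq> n} \<union>
     {num_hashes n k \<frown> y | k y. y \<in> the (ACC L (L \<alpha> j) w)})"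
proof -
  have w: "acc_instance L (L \<alpha> j) w"
    using assms(2) by (auto simp: ACC_def split: if_splits)
  then have "acc_instance L \<alpha> (hashes_num j n \<frown> w)"
    using assms(1) by (rule acc_instance.intros(2)[rotated])
  moreover have "acc_solution L \<alpha> (hashes_num j n \<frown> w) z \<longleftrightarrow>
      (\<exists>m q. z = Suc m ## q \<and> m \<noteq> n) \<or>
      (\<exists>k y. z = num_hashes n k \<frown> y \<and> acc_solution L (L \<alpha> j) w y)" for z
    using w assms(1) by (subst acc_solution.simps) auto
  ultimately show ?thesis
    using w by (simp add: ACC_def) blast
qed


section \<open>The discontinuity game\<close>

text \<open>
  The constructors are the stages of a round: \<open>Start \<alpha> P\<close> (Player 1 is to play an instance of
  \<open>P\<close>), \<open>Instance_Played \<alpha> P p\<close> (Player 2 is to play a solution), \<open>Solution_Played \<alpha> P p q\<close>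
  (Player 1 is to play an initial segment of \<open>q\<close>), \<open>Left_Played \<alpha> P p \<rho>\<close> (Player 2 is to play an
  initial segment of \<open>p\<close>) and \<open>Right_Played \<alpha> P \<rho> \<sigma>\<close> (Player 1 is to lower the rank).
\<close>

datatype game_state =
    Start omega1 problem
  | Instance_Played omega1 problem baire
  | Solution_Played omega1 problem baire baire
  | Left_Played omega1 problem baire "nat list"
  | Right_Played omega1 problem "nat list" "nat list"

datatype move = Point baire | Segment "nat list" | Rank omega1

inductive legal_move :: "game_state \<Rightarrow> move \<Rightarrow> game_state \<Rightarrow> bool"
  where
    "p \<in> dom P \<Longrightarrow> legal_move (Start \<alpha> P) (Point p) (Instance_Played \<alpha> P p)"
  | "q \<in> the (P p) \<Longrightarrow>
      legal_move (Instance_Played \<alpha> P p) (Point q) (Solution_Played \<alpha> P p q)"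
  | "\<alpha> \<noteq> 0 \<Longrightarrow> \<rho> \<sqsubseteq> q \<Longrightarrow>
      legal_move (Solution_Played \<alpha> P p q) (Segment \<rho>) (Left_Played \<alpha> P p \<rho>)"
  | "\<sigma> \<sqsubseteq> p \<Longrightarrow>
      legal_move (Left_Played \<alpha> P p \<rho>) (Segment \<sigma>) (Right_Played \<alpha> P \<rho> \<sigma>)"
  | "\<gamma> < \<alpha> \<Longrightarrow>
      legal_move (Right_Played \<alpha> P \<rho> \<sigma>) (Rank \<gamma>)
        (Start \<gamma> (restrict_problem P (cylinder \<sigma>) (cylinder \<rho>)))"

fun player1_to_move :: "game_state \<Rightarrow> bool"
  where
    "player1_to_move (Start \<alpha> P) \<longleftrightarrow> True"
  | "player1_to_move (Instance_Played \<alpha> P p) \<longleftrightarrow> False"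
  | "player1_to_move (Solution_Played \<alpha> P p q) \<longleftrightarrow> True"
  | "player1_to_move (Left_Played \<alpha> P p \<rho>) \<longleftrightarrow> False"
  | "player1_to_move (Right_Played \<alpha> P \<rho> \<sigma>) \<longleftrightarrow> True"

definition player1_won :: "game_state \<Rightarrow> bool"
  where "player1_won S \<longleftrightarrow> (\<exists>\<alpha> P p. S = Instance_Played \<alpha> P p \<and> the (P p) = {})"

text \<open>
  A strategy for Player 1 maps the list of all moves made so far to the next move, and
  \<open>play s S\<^sub>0 h S\<close> says that the moves \<open>h\<close> lead from \<open>S\<^sub>0\<close> to \<open>S\<close>, are legal, and agree with
  the strategy \<open>s\<close> at the turns of Player 1.
\<close>

type_synonym strategy = "move list \<Rightarrow> move"

inductive play :: "strategy \<Rightarrow> game_state \<Rightarrow> move list \<Rightarrow> game_state \<Rightarrow> bool"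
  for s :: strategy and S\<^sub>0 :: game_state
  where
    "play s S\<^sub>0 [] S\<^sub>0"
  | "play s S\<^sub>0 h S \<Longrightarrow> player1_to_move S \<Longrightarrow> legal_move S (s h) S' \<Longrightarrow> play s S\<^sub>0 (h @ [s h]) S'"
  | "play s S\<^sub>0 h S \<Longrightarrow> \<not> player1_to_move S \<Longrightarrow> legal_move S m S' \<Longrightarrow> play s S\<^sub>0 (h @ [m]) S'"

text \<open>
  Every play is finite (\<open>wf_legal_move\<close>), so a strategy of Player 1 is winning iff she has won at the
  end of every play that agrees with it and cannot be continued.  A play also ends, and is
  not won by her, when \<open>\<alpha> = 0\<close> after a solution was played or when the strategy
  proposes an illegal move.
\<close>

definition winning_strategy :: "strategy \<Rightarrow> game_state \<Rightarrow> bool"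
  where "winning_strategy s S\<^sub>0 \<longleftrightarrow>
    (\<forall>h S. play s S\<^sub>0 h S \<and> (\<nexists>m S'. play s S\<^sub>0 (h @ [m]) S') \<longrightarrow> player1_won S)"

lemma wf_legal_move: "wf {(S', S). \<exists>m. legal_move S m S'}"
proof -
  define meas :: "game_state \<Rightarrow> omega1 \<times> nat" where
    "meas S = (case S of Start \<alpha> P \<Rightarrow> (\<alpha>, 4) | Instance_Played \<alpha> P p \<Rightarrow> (\<alpha>, 3)
      | Solution_Played \<alpha> P p q \<Rightarrow> (\<alpha>, 2) | Left_Played \<alpha> P p \<rho> \<Rightarrow> (\<alpha>, 1)
      | Right_Played \<alpha> P \<rho> \<sigma> \<Rightarrow> (\<alpha>, 0))" for S
  have "wf (inv_image ({(x, y). x < y} <*lex*> less_than) meas)"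
    by (intro wf_inv_image wf_lex_prod wf wf_less_than)
  moreover have "{(S', S). \<exists>m. legal_move S m S'} \<subseteq>
      inv_image ({(x, y). x < y} <*lex*> less_than) meas"
    by (auto simp: meas_def elim!: legal_move.cases)
  ultimately show ?thesis by (rule wf_subset)
qed


section \<open>Rank of discontinuity\<close>

text \<open>
  The body of the recursive clause; \<open>R Q p'\<close> stands for \<open>p'\<close> being a discontinuity of \<open>Q\<close> of
  smaller rank.
\<close>

definition rank_condition :: "(problem \<Rightarrow> baire \<Rightarrow> bool) \<Rightarrow> problem \<Rightarrow> baire \<Rightarrow> bool"
  where "rank_condition R P p \<longleftrightarrow>
    (\<forall>q \<in> the (P p). \<exists>\<rho>. \<rho> \<sqsubseteq> q \<and>
      (\<forall>\<sigma>. \<sigma> \<sqsubseteq> p \<longrightarrow>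
        (\<exists>p' \<in> dom P \<inter> cylinder \<sigma>. p' \<noteq> p \<and>
          R (restrict_problem P (cylinder \<sigma>) (cylinder \<rho>)) p')))"

function rank_discontinuity :: "omega1 \<Rightarrow> problem \<Rightarrow> baire \<Rightarrow> bool"
  where "rank_discontinuity \<alpha> P p \<longleftrightarrow>
    discontinuity P p \<and>
    (if the (P p) = {} then \<alpha> = 0
     else 0 < \<alpha> \<and>
       rank_condition (\<lambda>Q p'. \<exists>\<beta>\<in>{..<\<alpha>}. rank_discontinuity \<beta> Q p') P p \<and>
       (\<forall>\<gamma>\<in>{..<\<alpha>}.
          \<not> rank_condition (\<lambda>Q p'. \<exists>\<beta>\<in>{..<\<gamma>}. rank_discontinuity \<beta> Q p') P p))"
  by pat_completeness auto
termination
  by (relation "inv_image {(x, y). x < y} fst") (auto intro!: wf intro: less_trans)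

declare rank_discontinuity.simps [simp del]

end

theory Submission
  imports Defs
begin

text \<open>
  All four conditions are compared with one inductive predicate, \<open>wins \<alpha> P p\<close>, which is the
  discontinuity game with strategies unfolded into alternating quantifiers: whatever solution
  \<open>q\<close> of \<open>p\<close> is proposed, some initial segment of \<open>q\<close> is such that in every neighbourhood of
  \<open>p\<close> there is an instance from which the game of some smaller rank is won, the solutions being
  restricted to those that extend the segment.

  \<^item> The game: every play is finite, so a winning strategy is the same as membership of the initial
    state in the set of winning positions, and that membership unfolds to \<open>wins\<close>.

  \<^item> The rank of discontinuity: its recursion asks for an instance different from \<open>p\<close> and for a
    point of discontinuity, the game for neither.  The second holds automatically
    (\<open>wins_discontinuity\<close>), since a continuous solution would tell how to beat the strategy; the
    first can be arranged by keeping the solution \<open>q\<close> fixed and taking the rank that is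
    least when the instance does not move (\<open>wins_other_point\<close>).

  \<^item> Reductions: given a reduction of \<open>ACC\<close> to \<open>P\<close>, the first number \<open>m\<close> of its answer
    on the instance that consists of hashes only is fixed by finitely many letters of the instance and
    of \<open>q\<close>.  Late instances that forbid just this \<open>m\<close> force the reduction to solve the smaller
    instance that follows, and this reduces an \<open>ACC\<close> problem of smaller rank to the restricted
    problem (\<open>ACC_reduction_imp_wins\<close>).  Conversely the initial segments that Player 1 may play are
    countably many, so they can be numbered, and forbidding the number \<open>n\<close> is translated into
    moving to the instance that answers the \<open>n\<close>-th segment (\<open>ACC_gluing\<close>).  The delicate points are
    that the rank granted after \<open>j\<close> hashes may be too small for the answer, so that a segment becomes
    usable only from some \<open>j\<close> on, and that the instances chosen must converge to \<open>p\<close> uniformly in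
    \<open>n\<close>.

  \<^item> Sets of small rank: a point of discontinuity \<open>p\<close> has, for each solution \<open>q\<close>, a segment
    of \<open>q\<close> and arbitrarily close other points of discontinuity of the restricted problem.  Otherwise
    the local solutions around the other points glue to a continuous solution with value \<open>q\<close> at \<open>p\<close>
    (\<open>discontinuity_nearby\<close>).  Close to \<open>p\<close> the other points of the set have smaller
    rank, which gives \<open>wins\<close> by induction.  Conversely a set is
    built by placing sets for smaller ranks into disjoint shells that shrink to \<open>p\<close>, each
    segment being treated in infinitely many shells (\<open>wins_imp_discontinuity_on_set\<close>).
\<close>

section \<open>Cylinders and continuity\<close>

lemma mem_cylinder_iff: "x \<in> cylinder \<sigma> \<longleftrightarrow> prefix (length \<sigma>) x = \<sigma>"
proof
  assume "x \<in> cylinder \<sigma>"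
  then obtain y where "x = \<sigma> \<frown> y" by (auto simp: cylinder_def initial_segment_def)
  then show "prefix (length \<sigma>) x = \<sigma>" by simp
next
  assume *: "prefix (length \<sigma>) x = \<sigma>"
  have "x = \<sigma> \<frown> suffix (length \<sigma>) x"
    by (subst *[symmetric]) (rule prefix_suffix)
  then show "x \<in> cylinder \<sigma>" unfolding cylinder_def initial_segment_def by blast
qed

lemma mem_cylinder_nth: "x \<in> cylinder \<sigma> \<longleftrightarrow> (\<forall>i<length \<sigma>. x i = \<sigma> ! i)"
proof -
  have "prefix (length \<sigma>) x = \<sigma> \<longleftrightarrow> (\<forall>i<length \<sigma>. prefix (length \<sigma>) x ! i = \<sigma> ! i)"
    unfolding list_eq_iff_nth_eq[of "prefix (length \<sigma>) x"] by simp
  also have "\<dots> \<longleftrightarrow> (\<forall>i<length \<sigma>. x i = \<sigma> ! i)" by simp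
  finally show ?thesis unfolding mem_cylinder_iff .
qed

lemma initial_segment_iff: "\<sigma> \<sqsubseteq> x \<longleftrightarrow> (\<exists>k. \<sigma> = prefix k x)"
proof -
  have "\<sigma> \<sqsubseteq> x \<longleftrightarrow> prefix (length \<sigma>) x = \<sigma>"
    unfolding mem_cylinder_iff[symmetric] by (simp add: cylinder_def)
  also have "\<dots> \<longleftrightarrow> (\<exists>k. \<sigma> = prefix k x)"
  proof
    assume "prefix (length \<sigma>) x = \<sigma>"
    from this[symmetric] show "\<exists>k. \<sigma> = prefix k x" by (rule exI)
  next
    assume "\<exists>k. \<sigma> = prefix k x"
    then obtain k where "\<sigma> = prefix k x" ..
    then show "prefix (length \<sigma>) x = \<sigma>" by simp
  qed
  finally show ?thesis .
qed

text \<open>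
  Since an initial segment of a known sequence is determined by its length, the basic
  neighbourhoods of \<open>x\<close> are indexed by numbers.
\<close>

abbreviation nbhd :: "nat \<Rightarrow> baire \<Rightarrow> baire set"
  where "nbhd k x \<equiv> cylinder (prefix k x)"

lemma mem_nbhd: "y \<in> nbhd k x \<longleftrightarrow> (\<forall>i<k. y i = x i)"
  by (simp add: mem_cylinder_nth)

lemma mem_nbhd_self [simp]: "x \<in> nbhd k x"
  by (simp add: mem_nbhd)

lemma nbhd_antimono: "k \<le> l \<Longrightarrow> nbhd l x \<subseteq> nbhd k x"
  by (auto simp: mem_nbhd)

lemma cylinder_Nil [simp]: "cylinder [] = UNIV"
  by (auto simp: mem_cylinder_nth)

lemma nbhd_eq: "y \<in> nbhd k x \<Longrightarrow> nbhd k y = nbhd k x"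
  by (auto simp: mem_nbhd)

lemma prefix_eq: "y \<in> nbhd k x \<Longrightarrow> prefix k y = prefix k x"
  by (simp add: mem_cylinder_iff)

lemma open_cylinder [simp]: "open (cylinder \<sigma>)"
proof -
  have "cylinder \<sigma> = (\<Inter>i\<in>{..<length \<sigma>}. (\<lambda>x. x i) -` {\<sigma> ! i})"
    by (auto simp: mem_cylinder_nth)
  moreover have "open ((\<lambda>x::baire. x i) -` {a})" for i a
    by (rule open_vimage) (simp_all add: open_discrete continuous_on_product_coordinates)
  ultimately show ?thesis by (simp add: open_INT)
qed

lemma open_contains_nbhd:
  assumes "open U" "x \<in> U"
  shows "\<exists>k. nbhd k x \<subseteq> U"
proof -
  from assms obtain X where X: "x \<in> Pi\<^sub>E UNIV X" "finite {i. X i \<noteq> UNIV}" "Pi\<^sub>E UNIV X \<subseteq> U"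
    using product_topology_open_contains_basis[of "\<lambda>i::nat. euclidean :: nat topology" UNIV U x]
    by (auto simp: open_fun_def)
  obtain k where k: "\<And>i. X i \<noteq> UNIV \<Longrightarrow> i < k"
    using X(2) by (metis (mono_tags, lifting) finite_nat_set_iff_bounded mem_Collect_eq)
  have "nbhd k x \<subseteq> Pi\<^sub>E UNIV X"
    using X(1) k by (auto simp: mem_nbhd PiE_def Pi_def) (metis UNIV_I)
  then show ?thesis using X(3) by blast
qed

lemma continuous_on_baire_iff_open:
  fixes f :: "'a::topological_space \<Rightarrow> baire"
  shows "continuous_on D f \<longleftrightarrow>
    (\<forall>x\<in>D. \<forall>n. \<exists>U. open U \<and> x \<in> U \<and> (\<forall>y\<in>D \<inter> U. f y \<in> nbhd n (f x)))"
proof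
  assume c: "continuous_on D f"
  show "\<forall>x\<in>D. \<forall>n. \<exists>U. open U \<and> x \<in> U \<and> (\<forall>y\<in>D \<inter> U. f y \<in> nbhd n (f x))"
  proof (intro ballI allI)
    fix x n assume "x \<in> D"
    then show "\<exists>U. open U \<and> x \<in> U \<and> (\<forall>y\<in>D \<inter> U. f y \<in> nbhd n (f x))"
      using c[unfolded continuous_on_topological, rule_format, of x "nbhd n (f x)"] by auto
  qed
next
  assume r: "\<forall>x\<in>D. \<forall>n. \<exists>U. open U \<and> x \<in> U \<and> (\<forall>y\<in>D \<inter> U. f y \<in> nbhd n (f x))"
  show "continuous_on D f"
    unfolding continuous_on_topological
  proof (intro ballI allI impI)
    fix x B assume "x \<in> D" "open B" "f x \<in> B"
    moreover then obtain n where "nbhd n (f x) \<subseteq> B" using open_contains_nbhd by blast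
    ultimately show "\<exists>A. open A \<and> x \<in> A \<and> (\<forall>y\<in>D. y \<in> A \<longrightarrow> f y \<in> B)"
      using r by (metis IntI subset_eq)
  qed
qed

text \<open>
  Combinatorial form of continuity: finitely many values of \<open>f x\<close> are determined by finitely many
  values of \<open>x\<close>.
\<close>

lemma continuous_on_baire_iff:
  fixes f :: "baire \<Rightarrow> baire"
  shows "continuous_on D f \<longleftrightarrow> (\<forall>x\<in>D. \<forall>n. \<exists>k. \<forall>y\<in>D \<inter> nbhd k x. f y \<in> nbhd n (f x))"
  unfolding continuous_on_baire_iff_open
proof (intro ball_cong refl iff_allI iffI; elim exE conjE)
  fix x n U assume "open U" "x \<in> U" and U: "\<forall>y\<in>D \<inter> U. f y \<in> nbhd n (f x)"
  then obtain k where "nbhd k x \<subseteq> U" using open_contains_nbhd by blast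
  with U show "\<exists>k. \<forall>y\<in>D \<inter> nbhd k x. f y \<in> nbhd n (f x)" by blast
next
  fix x n k assume "\<forall>y\<in>D \<inter> nbhd k x. f y \<in> nbhd n (f x)"
  then show "\<exists>U. open U \<and> x \<in> U \<and> (\<forall>y\<in>D \<inter> U. f y \<in> nbhd n (f x))"
    by (intro exI[of _ "nbhd k x"]) simp
qed

lemma continuous_on_baire_pair_iff:
  fixes f :: "baire \<times> baire \<Rightarrow> baire"
  shows "continuous_on D f \<longleftrightarrow>
    (\<forall>x q. (x, q) \<in> D \<longrightarrow> (\<forall>n. \<exists>k. \<forall>x' q'. (x', q') \<in> D \<longrightarrow> x' \<in> nbhd k x \<longrightarrow> q' \<in> nbhd k q \<longrightarrow>
      f (x', q') \<in> nbhd n (f (x, q))))" (is "_ \<longleftrightarrow> ?R")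
proof
  assume c: "continuous_on D f"
  show ?R
  proof (intro allI impI)
    fix x q n assume "(x, q) \<in> D"
    then obtain U where U: "open U" "(x, q) \<in> U" "\<And>y. y \<in> D \<Longrightarrow> y \<in> U \<Longrightarrow> f y \<in> nbhd n (f (x, q))"
      using c unfolding continuous_on_baire_iff_open by (metis IntI)
    then obtain A B where AB: "open A" "open B" "x \<in> A" "q \<in> B" "A \<times> B \<subseteq> U"
      by (auto elim!: open_prod_elim)
    obtain k l where kl: "nbhd k x \<subseteq> A" "nbhd l q \<subseteq> B"
      using AB open_contains_nbhd by metis
    have "nbhd (max k l) x \<subseteq> A" "nbhd (max k l) q \<subseteq> B"
      using kl nbhd_antimono[of k "max k l" x] nbhd_antimono[of l "max k l" q] by auto
    then show "\<exists>k. \<forall>x' q'. (x', q') \<in> D \<longrightarrow> x' \<in> nbhd k x \<longrightarrow> q' \<in> nbhd k q \<longrightarrow>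
        f (x', q') \<in> nbhd n (f (x, q))"
      using U(3) AB(5) by blast
  qed
next
  assume r: ?R
  show "continuous_on D f"
    unfolding continuous_on_baire_iff_open
  proof (intro ballI allI)
    fix z n assume z: "z \<in> D"
    obtain x q where xq: "z = (x, q)" by fastforce
    obtain k where k: "\<forall>x' q'. (x', q') \<in> D \<longrightarrow> x' \<in> nbhd k x \<longrightarrow> q' \<in> nbhd k q \<longrightarrow>
        f (x', q') \<in> nbhd n (f (x, q))" using r z xq by blast
    then show "\<exists>U. open U \<and> z \<in> U \<and> (\<forall>y\<in>D \<inter> U. f y \<in> nbhd n (f z))"
      by (intro exI[of _ "nbhd k x \<times> nbhd k q"]) (auto simp: xq open_Times)
  qed
qed


section \<open>Problems and their solutions by continuous functions\<close>

lemma dom_restrict_problem [simp]: "dom (restrict_problem P A B) = dom P \<inter> A"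
  by (auto simp: restrict_problem_def restrict_map_def split: if_splits)

lemma the_restrict_problem:
  "x \<in> dom P \<inter> A \<Longrightarrow> the (restrict_problem P A B x) = the (P x) \<inter> B"
  by (auto simp: restrict_problem_def restrict_map_def)

lemma restrict_map_eq_restrict_problem: "P |` A = restrict_problem P A UNIV"
  by (rule ext) (simp add: restrict_problem_def restrict_map_def option.map_ident)

lemma restrict_problem_restrict_problem:
  "restrict_problem (restrict_problem P A B) A' B' = restrict_problem P (A \<inter> A') (B \<inter> B')"
  by (rule ext) (auto simp: restrict_problem_def restrict_map_def option.map_comp o_def Int_assoc)

text \<open>
  \<open>P\<close> is at least as hard as \<open>Q\<close> in the strongest sense: on the instances of \<open>Q\<close>, solving \<open>P\<close> is
  solving \<open>Q\<close>.  Every notion of discontinuity below is inherited along this relation, and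
  every comparison between restrictions of one problem is an instance of it.
\<close>

definition harder :: "problem \<Rightarrow> problem \<Rightarrow> bool"
  where "harder P Q \<longleftrightarrow> (\<forall>x\<in>dom Q. x \<in> dom P \<and> the (P x) \<subseteq> the (Q x))"

lemma harder_refl [simp]: "harder P P"
  by (simp add: harder_def)

lemma harder_restrict_problem:
  assumes "harder P Q" "dom Q \<inter> A' \<subseteq> A" "B \<subseteq> B'"
  shows "harder (restrict_problem P A B) (restrict_problem Q A' B')"
  unfolding harder_def
proof
  fix x assume "x \<in> dom (restrict_problem Q A' B')"
  then have x: "x \<in> dom Q \<inter> A'" by simp
  then have P: "x \<in> dom P" "the (P x) \<subseteq> the (Q x)" using assms(1) unfolding harder_def by blast+
  then have "x \<in> dom P \<inter> A" using x assms(2) by blast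
  then show "x \<in> dom (restrict_problem P A B) \<and>
      the (restrict_problem P A B x) \<subseteq> the (restrict_problem Q A' B' x)"
    unfolding dom_restrict_problem using x P(2) assms(3)
    by (simp only: the_restrict_problem) blast
qed

lemma continuous_problem_iff:
  "continuous_problem P \<longleftrightarrow> (\<exists>f. continuous_on (dom P) f \<and> (\<forall>x\<in>dom P. f x \<in> the (P x)))"
proof
  assume "continuous_problem P"
  then obtain \<Phi> where \<Phi>: "continuous_partial \<Phi>" "\<forall>p\<in>dom P. \<exists>q\<in>the (P p). \<Phi> p = Some q"
    unfolding continuous_problem_def by blast
  have \<Phi>_in: "x \<in> dom \<Phi> \<and> the (\<Phi> x) \<in> the (P x)" if x: "x \<in> dom P" for x
  proof -
    obtain q where "q \<in> the (P x)" "\<Phi> x = Some q" using bspec[OF \<Phi>(2) x] by blast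
    then show ?thesis by auto
  qed
  have "continuous_on (dom P) (\<lambda>x. the (\<Phi> x))"
    using \<Phi>(1) unfolding continuous_partial_def by (rule continuous_on_subset) (use \<Phi>_in in blast)
  then show "\<exists>f. continuous_on (dom P) f \<and> (\<forall>x\<in>dom P. f x \<in> the (P x))"
    using \<Phi>_in by blast
next
  assume "\<exists>f. continuous_on (dom P) f \<and> (\<forall>x\<in>dom P. f x \<in> the (P x))"
  then obtain f where f: "continuous_on (dom P) f" "\<forall>x\<in>dom P. f x \<in> the (P x)" by blast
  define \<Phi> where "\<Phi> = (\<lambda>x. if x \<in> dom P then Some (f x) else None)"
  have dom: "dom \<Phi> = dom P" unfolding \<Phi>_def dom_def by simp
  have \<Phi>: "\<Phi> x = Some (f x)" if "x \<in> dom P" for x using that by (simp only: \<Phi>_def if_True)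
  have "continuous_on (dom P) (\<lambda>x. the (\<Phi> x))"
    using f(1) by (rule continuous_on_eq) (simp only: \<Phi> option.sel)
  then have "continuous_partial \<Phi>" unfolding continuous_partial_def dom .
  then show "continuous_problem P"
    unfolding continuous_problem_def using f(2) \<Phi> by blast
qed

lemma continuous_problem_harder:
  assumes "harder P Q" "continuous_problem P"
  shows "continuous_problem Q"
proof -
  obtain f where f: "continuous_on (dom P) f" "\<forall>x\<in>dom P. f x \<in> the (P x)"
    using assms(2) unfolding continuous_problem_iff by blast
  have "continuous_on (dom Q) f"
    using f(1) by (rule continuous_on_subset) (use assms(1) in \<open>auto simp: harder_def\<close>)
  moreover have "\<forall>x\<in>dom Q. f x \<in> the (Q x)" using assms(1) f(2) by (auto simp: harder_def)
  ultimately show ?thesis unfolding continuous_problem_iff by blast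
qed

lemma discontinuity_iff:
  "discontinuity P p \<longleftrightarrow>
    p \<in> dom P \<and> (\<forall>k. \<not> continuous_problem (restrict_problem P (nbhd k p) UNIV))"
proof -
  have *: "continuous_problem (restrict_problem P (nbhd k p) UNIV)"
    if "continuous_problem (restrict_problem P U UNIV)" "nbhd k p \<subseteq> U" for U k
    by (rule continuous_problem_harder[OF harder_restrict_problem that(1)]) (use that(2) in auto)
  have "(\<exists>U. open U \<and> p \<in> U \<and> continuous_problem (restrict_problem P U UNIV)) \<longleftrightarrow>
      (\<exists>k. continuous_problem (restrict_problem P (nbhd k p) UNIV))"
  proof (intro iffI; elim exE conjE)
    fix U assume "open U" "p \<in> U" "continuous_problem (restrict_problem P U UNIV)"
    moreover obtain k where "nbhd k p \<subseteq> U"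
      using open_contains_nbhd[OF \<open>open U\<close> \<open>p \<in> U\<close>] by blast
    ultimately show "\<exists>k. continuous_problem (restrict_problem P (nbhd k p) UNIV)" using * by blast
  next
    fix k assume "continuous_problem (restrict_problem P (nbhd k p) UNIV)"
    then show "\<exists>U. open U \<and> p \<in> U \<and> continuous_problem (restrict_problem P U UNIV)"
      by (intro exI[of _ "nbhd k p"]) simp
  qed
  then show ?thesis
    unfolding discontinuity_def restrict_map_eq_restrict_problem by (simp only: not_ex)
qed

lemma discontinuity_harder:
  assumes "harder P Q" "discontinuity Q p"
  shows "discontinuity P p"
proof -
  have "harder (restrict_problem P (nbhd k p) UNIV) (restrict_problem Q (nbhd k p) UNIV)" for k
    by (rule harder_restrict_problem[OF assms(1)]) auto
  moreover have "p \<in> dom P" using assms by (auto simp: harder_def discontinuity_def)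
  ultimately show ?thesis
    using assms(2) continuous_problem_harder unfolding discontinuity_iff by blast
qed

lemma discontinuity_imp_not_continuous: "discontinuity P p \<Longrightarrow> \<not> continuous_problem P"
proof
  assume d: "discontinuity P p" and c: "continuous_problem P"
  have "harder P (restrict_problem P (nbhd 0 p) UNIV)"
    by (auto simp: harder_def the_restrict_problem)
  then have "continuous_problem (restrict_problem P (nbhd 0 p) UNIV)"
    using c by (rule continuous_problem_harder)
  then show False using d unfolding discontinuity_iff by blast
qed


section \<open>Winning instances\<close>

text \<open>
  The game with initial move \<open>p\<close>, read as a formula: \<open>l\<close> and \<open>k\<close> are the lengths of the segments of
  \<open>q\<close> and \<open>p\<close> that the players choose.  An instance without solutions wins vacuously, and a solution of
  \<open>p\<close> forces \<open>0 < \<alpha>\<close> because a smaller rank must exist.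
\<close>

inductive wins :: "omega1 \<Rightarrow> problem \<Rightarrow> baire \<Rightarrow> bool"
  where
    "p \<in> dom P \<Longrightarrow>
      (\<And>q. q \<in> the (P p) \<Longrightarrow>
        \<exists>l. \<forall>k. \<exists>\<gamma><\<alpha>. \<exists>p'. wins \<gamma> (restrict_problem P (nbhd k p) (nbhd l q)) p') \<Longrightarrow>
      wins \<alpha> P p"

lemma wins_dom: "wins \<alpha> P p \<Longrightarrow> p \<in> dom P"
  by (erule wins.cases) simp

lemma wins_reply:
  assumes "wins \<alpha> P p" "q \<in> the (P p)"
  shows "\<exists>l. \<forall>k. \<exists>\<gamma><\<alpha>. \<exists>p'. wins \<gamma> (restrict_problem P (nbhd k p) (nbhd l q)) p'"
  using assms(1) by cases (use assms(2) in blast)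

lemma wins_iff:
  "wins \<alpha> P p \<longleftrightarrow> p \<in> dom P \<and> (\<forall>q\<in>the (P p).
      \<exists>l. \<forall>k. \<exists>\<gamma><\<alpha>. \<exists>p'. wins \<gamma> (restrict_problem P (nbhd k p) (nbhd l q)) p')"
proof
  assume w: "wins \<alpha> P p"
  show "p \<in> dom P \<and> (\<forall>q\<in>the (P p).
      \<exists>l. \<forall>k. \<exists>\<gamma><\<alpha>. \<exists>p'. wins \<gamma> (restrict_problem P (nbhd k p) (nbhd l q)) p')"
    using wins_dom[OF w] wins_reply[OF w] by (intro conjI ballI)
next
  assume "p \<in> dom P \<and> (\<forall>q\<in>the (P p).
      \<exists>l. \<forall>k. \<exists>\<gamma><\<alpha>. \<exists>p'. wins \<gamma> (restrict_problem P (nbhd k p) (nbhd l q)) p')"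
  then show "wins \<alpha> P p" by (intro wins.intros) (elim conjE bspec, assumption)+
qed

lemma wins_mono:
  assumes "wins \<alpha> P p" "\<alpha> \<le> \<beta>"
  shows "wins \<beta> P p"
proof (rule wins.intros)
  show "p \<in> dom P" using assms(1) by (rule wins_dom)
  fix q assume q: "q \<in> the (P p)"
  obtain l where l: "\<forall>k. \<exists>\<gamma><\<alpha>. \<exists>p'. wins \<gamma> (restrict_problem P (nbhd k p) (nbhd l q)) p'"
    using wins_reply[OF assms(1), OF q] ..
  have "\<exists>\<gamma><\<beta>. \<exists>p'. wins \<gamma> (restrict_problem P (nbhd k p) (nbhd l q)) p'" for k
    using l assms(2) less_le_trans by blast
  then show "\<exists>l. \<forall>k. \<exists>\<gamma><\<beta>. \<exists>p'. wins \<gamma> (restrict_problem P (nbhd k p) (nbhd l q)) p'"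
    by blast
qed

lemma wins_harder: "wins \<alpha> Q p \<Longrightarrow> harder P Q \<Longrightarrow> wins \<alpha> P p"
proof (induction arbitrary: P rule: wins.induct)
  case (1 p Q \<alpha>)
  show ?case
  proof (rule wins.intros)
    show "p \<in> dom P" using 1 by (simp add: harder_def)
    fix q assume "q \<in> the (P p)"
    then have "q \<in> the (Q p)" using 1 by (auto simp: harder_def)
    then obtain l where l: "\<forall>k. \<exists>\<gamma><\<alpha>. \<exists>p'. wins \<gamma> (restrict_problem Q (nbhd k p) (nbhd l q)) p' \<and>
        (\<forall>P. harder P (restrict_problem Q (nbhd k p) (nbhd l q)) \<longrightarrow> wins \<gamma> P p')"
      using 1(2) by blast
    have "harder (restrict_problem P (nbhd k p) (nbhd l q)) (restrict_problem Q (nbhd k p) (nbhd l q))" for k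
      using 1(3) by (rule harder_restrict_problem) auto
    then show "\<exists>l. \<forall>k. \<exists>\<gamma><\<alpha>. \<exists>p'. wins \<gamma> (restrict_problem P (nbhd k p) (nbhd l q)) p'"
      using l by meson
  qed
qed

text \<open>
  Player 1 never has to repeat \<open>p\<close>.  With \<open>q\<close> fixed, let \<open>\<delta>\<close> be the least rank with which she wins from
  \<open>p\<close> after some segment of \<open>q\<close> has been imposed.  Her next move in a game of rank \<open>\<delta>\<close> against \<open>q\<close>
  has a smaller rank and imposes a segment of \<open>q\<close>, so it cannot be \<open>p\<close> again.
\<close>

lemma wins_other_point:
  assumes "wins \<alpha> P p" "q \<in> the (P p)"
  shows "\<exists>l. \<forall>k. \<exists>\<gamma><\<alpha>. \<exists>p'. p' \<noteq> p \<and> wins \<gamma> (restrict_problem P (nbhd k p) (nbhd l q)) p'"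
proof -
  let ?W = "\<lambda>\<gamma>. \<exists>l. wins \<gamma> (restrict_problem P UNIV (nbhd l q)) p"
  have "harder (restrict_problem P UNIV (nbhd 0 q)) P"
    using wins_dom[OF assms(1)] by (auto simp: harder_def the_restrict_problem)
  then have "?W \<alpha>" using wins_harder[OF assms(1)] by blast
  define \<delta> where "\<delta> = (LEAST \<gamma>. ?W \<gamma>)"
  have "?W \<delta>" unfolding \<delta>_def using \<open>?W \<alpha>\<close> by (rule LeastI)
  then obtain l where l: "wins \<delta> (restrict_problem P UNIV (nbhd l q)) p" ..
  have "\<delta> \<le> \<alpha>" unfolding \<delta>_def using \<open>?W \<alpha>\<close> by (rule Least_le)
  have min: "\<not> ?W \<gamma>" if "\<gamma> < \<delta>" for \<gamma> using that unfolding \<delta>_def by (rule not_less_Least)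
  have q: "q \<in> the (restrict_problem P UNIV (nbhd l q) p)"
    using assms(2) wins_dom[OF assms(1)] by (simp add: the_restrict_problem)
  obtain m where m: "\<forall>k. \<exists>\<gamma><\<delta>. \<exists>p'.
      wins \<gamma> (restrict_problem (restrict_problem P UNIV (nbhd l q)) (nbhd k p) (nbhd m q)) p'"
    using wins_reply[OF l, OF q] ..
  have eq: "restrict_problem (restrict_problem P UNIV (nbhd l q)) (nbhd k p) (nbhd m q) =
      restrict_problem P (nbhd k p) (nbhd (max l m) q)" for k
  proof -
    have "nbhd l q \<inter> nbhd m q = nbhd (max l m) q" by (auto simp: mem_nbhd less_max_iff_disj)
    then show ?thesis by (simp add: restrict_problem_restrict_problem)
  qed
  have "\<exists>\<gamma><\<alpha>. \<exists>p'. p' \<noteq> p \<and> wins \<gamma> (restrict_problem P (nbhd k p) (nbhd (max l m) q)) p'" for k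
  proof -
    obtain \<gamma> p' where *: "\<gamma> < \<delta>" "wins \<gamma> (restrict_problem P (nbhd k p) (nbhd (max l m) q)) p'"
      using m unfolding eq by blast
    have "harder (restrict_problem P UNIV (nbhd (max l m) q)) (restrict_problem P (nbhd k p) (nbhd (max l m) q))"
      by (rule harder_restrict_problem) auto
    then have "p' \<noteq> p" using min[OF *(1)] wins_harder[OF *(2)] by blast
    then show ?thesis using * \<open>\<delta> \<le> \<alpha>\<close> less_le_trans by blast
  qed
  then show ?thesis by blast
qed

text \<open>
  A continuous solution \<open>f\<close> near \<open>p\<close> is an answer to the strategy: against \<open>q = f p\<close> Player 1 imposes a
  segment of \<open>f p\<close>, continuity gives a neighbourhood of \<open>p\<close> that \<open>f\<close> maps into that segment, and so \<open>f\<close>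
  still solves the restricted problem, which the induction hypothesis excludes.
\<close>

lemma wins_discontinuity: "wins \<alpha> P p \<Longrightarrow> discontinuity P p"
proof (induction rule: wins.induct)
  case (1 p P \<alpha>)
  have False if c: "continuous_problem (restrict_problem P (nbhd k p) UNIV)" for k
  proof -
    let ?Q = "restrict_problem P (nbhd k p) UNIV"
    obtain f where f: "continuous_on (dom ?Q) f" "\<forall>x\<in>dom ?Q. f x \<in> the (?Q x)"
      using c unfolding continuous_problem_iff by blast
    have p: "p \<in> dom ?Q" using 1(1) by simp
    then have "f p \<in> the (P p)" using f(2) 1(1) by (auto simp: the_restrict_problem)
    then obtain l where l: "\<forall>k. \<exists>\<gamma><\<alpha>. \<exists>p'.
        discontinuity (restrict_problem P (nbhd k p) (nbhd l (f p))) p'"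
      using 1(2) by blast
    obtain m where m: "\<forall>y\<in>dom ?Q \<inter> nbhd m p. f y \<in> nbhd l (f p)"
      using f(1) p unfolding continuous_on_baire_iff by blast
    let ?R = "restrict_problem P (nbhd (max k m) p) (nbhd l (f p))"
    obtain p' where p': "discontinuity ?R p'" using l by blast
    have sub: "dom ?R \<subseteq> dom ?Q \<inter> nbhd m p" by (auto simp: mem_nbhd)
    have "f x \<in> the (?R x)" if "x \<in> dom ?R" for x
    proof -
      have "x \<in> dom ?Q" "f x \<in> nbhd l (f p)" using sub m that by blast+
      then have "f x \<in> the (P x) \<inter> nbhd l (f p)"
        using f(2) by (auto simp: the_restrict_problem)
      then show ?thesis using that by (simp add: the_restrict_problem)
    qed
    then have "continuous_problem ?R"
      unfolding continuous_problem_iff using continuous_on_subset[OF f(1)] sub by blast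
    then show False using p' discontinuity_imp_not_continuous by blast
  qed
  then show ?case unfolding discontinuity_iff using 1(1) by blast
qed


section \<open>Rank of discontinuity\<close>

lemma rank_condition_iff:
  "rank_condition R P p \<longleftrightarrow>
    (\<forall>q\<in>the (P p). \<exists>l. \<forall>k. \<exists>p'\<in>dom P \<inter> nbhd k p. p' \<noteq> p \<and>
      R (restrict_problem P (nbhd k p) (nbhd l q)) p')"
  unfolding rank_condition_def initial_segment_iff by blast

lemma rank_discontinuity_imp_wins: "rank_discontinuity \<beta> P p \<Longrightarrow> wins \<beta> P p"
proof (induction \<beta> arbitrary: P p rule: less_induct)
  case (less \<beta>)
  then have d: "discontinuity P p" by (simp add: rank_discontinuity.simps[of \<beta>])
  show ?case
  proof (rule wins.intros)
    show "p \<in> dom P" using d by (simp add: discontinuity_def)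
    fix q assume q: "q \<in> the (P p)"
    then have "the (P p) \<noteq> {}" by blast
    have
      "rank_condition (\<lambda>Q p'. \<exists>\<gamma>\<in>{..<\<beta>}. rank_discontinuity \<gamma> Q p') P p"
      using less.prems
      unfolding rank_discontinuity.simps[of \<beta>] if_not_P[OF \<open>the (P p) \<noteq> {}\<close>] by (elim conjE)
    with q obtain l where "\<forall>k. \<exists>p'. \<exists>\<gamma><\<beta>.
        rank_discontinuity \<gamma> (restrict_problem P (nbhd k p) (nbhd l q)) p'"
      unfolding rank_condition_iff by (meson lessThan_iff)
    with less.IH show "\<exists>l. \<forall>k. \<exists>\<gamma><\<beta>. \<exists>p'. wins \<gamma> (restrict_problem P (nbhd k p) (nbhd l q)) p'"
      by meson
  qed
qed

text \<open>
  The induction hypothesis only says that the rank condition holds at \<open>\<alpha>\<close>; the rank of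
  discontinuity is the least ordinal at which it holds.
\<close>

lemma wins_imp_rank_discontinuity: "wins \<alpha> P p \<Longrightarrow> \<exists>\<beta>\<le>\<alpha>. rank_discontinuity \<beta> P p"
proof (induction \<alpha> arbitrary: P p rule: less_induct)
  case (less \<alpha>)
  have d: "discontinuity P p" using less.prems by (rule wins_discontinuity)
  show ?case
  proof (cases "the (P p) = {}")
    case True
    then have "rank_discontinuity 0 P p" using d by (simp add: rank_discontinuity.simps[of 0])
    then show ?thesis using zero_le_omega1 by blast
  next
    case False
    let ?C = "\<lambda>\<beta>. rank_condition (\<lambda>Q p'. \<exists>\<gamma>\<in>{..<\<beta>}. rank_discontinuity \<gamma> Q p') P p"
    have "?C \<alpha>"
      unfolding rank_condition_iff
    proof
      fix q assume "q \<in> the (P p)"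
      then obtain l where l: "\<forall>k. \<exists>\<gamma><\<alpha>. \<exists>p'. p' \<noteq> p \<and>
          wins \<gamma> (restrict_problem P (nbhd k p) (nbhd l q)) p'"
        using wins_other_point[OF less.prems] by blast
      have "\<exists>p'\<in>dom P \<inter> nbhd k p. p' \<noteq> p \<and>
          (\<exists>\<gamma>\<in>{..<\<alpha>}. rank_discontinuity \<gamma> (restrict_problem P (nbhd k p) (nbhd l q)) p')" for k
      proof -
        obtain \<gamma> p' where *: "\<gamma> < \<alpha>" "p' \<noteq> p" "wins \<gamma> (restrict_problem P (nbhd k p) (nbhd l q)) p'"
          using l by blast
        obtain \<beta> where "\<beta> \<le> \<gamma>" "rank_discontinuity \<beta> (restrict_problem P (nbhd k p) (nbhd l q)) p'"
          using less.IH[OF *(1,3)] by blast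
        moreover have "p' \<in> dom P \<inter> nbhd k p" using wins_dom[OF *(3)] by simp
        ultimately show ?thesis using * le_less_trans by blast
      qed
      then show "\<exists>l. \<forall>k. \<exists>p'\<in>dom P \<inter> nbhd k p. p' \<noteq> p \<and>
          (\<exists>\<gamma>\<in>{..<\<alpha>}. rank_discontinuity \<gamma> (restrict_problem P (nbhd k p) (nbhd l q)) p')"
        by blast
    qed
    define \<beta> where "\<beta> = (LEAST \<beta>. ?C \<beta>)"
    have "?C \<beta>" unfolding \<beta>_def using \<open>?C \<alpha>\<close> by (rule LeastI)
    have "\<beta> \<noteq> 0"
    proof
      assume "\<beta> = 0"
      obtain q where q: "q \<in> the (P p)" using False by blast
      have "{..<0 :: omega1} = {}" by auto
      with \<open>?C \<beta>\<close> q show False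
        unfolding rank_condition_iff \<open>\<beta> = 0\<close> by (simp only: bex_empty) blast
    qed
    then have pos: "0 < \<beta>" by (simp add: zero_less_omega1_iff)
    have least: "\<forall>\<gamma>\<in>{..<\<beta>}. \<not> ?C \<gamma>"
    proof
      fix \<gamma> assume "\<gamma> \<in> {..<\<beta>}"
      then have "\<gamma> < (LEAST \<beta>. ?C \<beta>)" by (simp add: \<beta>_def)
      then show "\<not> ?C \<gamma>" by (rule not_less_Least)
    qed
    have "rank_discontinuity \<beta> P p"
      unfolding rank_discontinuity.simps[of \<beta>] if_not_P[OF False]
      by (intro conjI; fact)
    moreover have "\<beta> \<le> \<alpha>" unfolding \<beta>_def using \<open>?C \<alpha>\<close> by (rule Least_le)
    ultimately show ?thesis by blast
  qed
qed

theorem rank_discontinuity_iff_wins: "(\<exists>\<beta>\<le>\<alpha>. rank_discontinuity \<beta> P p) \<longleftrightarrow> wins \<alpha> P p"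
  using rank_discontinuity_imp_wins wins_imp_rank_discontinuity wins_mono by blast


section \<open>The discontinuity game\<close>

text \<open>
  Backward induction over the game graph.  Positions where the opponent has no move count as winning; the
  only such positions are the instances without solutions, because the empty segment is always available.
\<close>

inductive winning_position :: "game_state \<Rightarrow> bool"
  where
    player1: "player1_to_move S \<Longrightarrow> legal_move S m S' \<Longrightarrow> winning_position S' \<Longrightarrow>
      winning_position S"
  | player2: "\<not> player1_to_move S \<Longrightarrow> (\<And>m S'. legal_move S m S' \<Longrightarrow> winning_position S') \<Longrightarrow>
      winning_position S"

lemma winning_position_player1_iff:
  "player1_to_move S \<Longrightarrow> winning_position S \<longleftrightarrow> (\<exists>m S'. legal_move S m S' \<and> winning_position S')"
  by (subst winning_position.simps) simp

lemma winning_position_player2_iff: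
  "\<not> player1_to_move S \<Longrightarrow> winning_position S \<longleftrightarrow> (\<forall>m S'. legal_move S m S' \<longrightarrow> winning_position S')"
  by (subst winning_position.simps) simp

lemma winning_position_Start:
  "winning_position (Start \<alpha> P) \<longleftrightarrow> (\<exists>p\<in>dom P. winning_position (Instance_Played \<alpha> P p))"
  by (subst winning_position_player1_iff) (auto simp: legal_move.simps)

lemma winning_position_Instance_Played:
  "winning_position (Instance_Played \<alpha> P p) \<longleftrightarrow>
    (\<forall>q\<in>the (P p). winning_position (Solution_Played \<alpha> P p q))"
  by (subst winning_position_player2_iff) (auto simp: legal_move.simps)

lemma winning_position_Solution_Played:
  "winning_position (Solution_Played \<alpha> P p q) \<longleftrightarrow>
    \<alpha> \<noteq> 0 \<and> (\<exists>l. winning_position (Left_Played \<alpha> P p (prefix l q)))"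
  by (subst winning_position_player1_iff) (auto simp: legal_move.simps initial_segment_iff)

lemma winning_position_Left_Played:
  "winning_position (Left_Played \<alpha> P p \<rho>) \<longleftrightarrow>
    (\<forall>k. winning_position (Right_Played \<alpha> P \<rho> (prefix k p)))"
  by (subst winning_position_player2_iff) (auto simp: legal_move.simps initial_segment_iff)

lemma winning_position_Right_Played:
  "winning_position (Right_Played \<alpha> P \<rho> \<sigma>) \<longleftrightarrow>
    (\<exists>\<gamma><\<alpha>. winning_position (Start \<gamma> (restrict_problem P (cylinder \<sigma>) (cylinder \<rho>))))"
  by (subst winning_position_player1_iff) (auto simp: legal_move.simps)

lemma winning_position_iff_wins:
  "p \<in> dom P \<Longrightarrow> winning_position (Instance_Played \<alpha> P p) \<longleftrightarrow> wins \<alpha> P p"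
proof (induction \<alpha> arbitrary: P p rule: less_induct)
  case (less \<alpha>)
  have "winning_position (Start \<gamma> Q) \<longleftrightarrow> (\<exists>p'. wins \<gamma> Q p')" if "\<gamma> < \<alpha>" for \<gamma> Q
    unfolding winning_position_Start using less.IH[OF that] wins_dom by blast
  then have "winning_position (Right_Played \<alpha> P \<rho> \<sigma>) \<longleftrightarrow>
      (\<exists>\<gamma><\<alpha>. \<exists>p'. wins \<gamma> (restrict_problem P (cylinder \<sigma>) (cylinder \<rho>)) p')" for \<rho> \<sigma>
    unfolding winning_position_Right_Played by (simp cong: conj_cong)
  moreover have "\<alpha> \<noteq> 0" if "\<exists>\<gamma><\<alpha>. R \<gamma>" for R :: "omega1 \<Rightarrow> bool"
    using that by auto
  ultimately show ?case
    unfolding winning_position_Instance_Played winning_position_Solution_Played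
      winning_position_Left_Played wins_iff[of \<alpha> P p]
    using less.prems by (simp only: simp_thms) blast
qed

lemma legal_move_deterministic: "legal_move S m S1 \<Longrightarrow> legal_move S m S2 \<Longrightarrow> S1 = S2"
  by (erule legal_move.cases; erule legal_move.cases; simp)

text \<open>
  A strategy sees only the history; \<open>reaches\<close> recovers the position from it, uniquely because a
  legal move determines the next position.
\<close>

fun reaches :: "game_state \<Rightarrow> move list \<Rightarrow> game_state \<Rightarrow> bool"
  where
    "reaches S [] T \<longleftrightarrow> S = T"
  | "reaches S (m # h) T \<longleftrightarrow> (\<exists>S'. legal_move S m S' \<and> reaches S' h T)"

lemma reaches_snoc: "reaches S (h @ [m]) T \<longleftrightarrow> (\<exists>S'. reaches S h S' \<and> legal_move S' m T)"
  by (induction h arbitrary: S) auto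

lemma reaches_deterministic: "reaches S h T1 \<Longrightarrow> reaches S h T2 \<Longrightarrow> T1 = T2"
  by (induction h arbitrary: S) (auto dest: legal_move_deterministic)

lemma play_reaches: "play s S\<^sub>0 h S \<Longrightarrow> reaches S\<^sub>0 h S"
  by (induction rule: play.induct) (auto simp: reaches_snoc)

lemma play_snoc_iff:
  "play s S\<^sub>0 (h @ [m]) S' \<longleftrightarrow>
    (\<exists>S. play s S\<^sub>0 h S \<and> (player1_to_move S \<longrightarrow> m = s h) \<and> legal_move S m S')"
  by (subst play.simps) auto

text \<open>
  From a winning strategy, induction along the well-founded move relation shows that every position that
  occurs in a play following it is winning.  Conversely, the strategy that always moves
  to some winning position keeps the play inside winning positions, and a play that stops there has been
  won.
\<close>

lemma ex_winning_strategy_iff: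
  "(\<exists>s. winning_strategy s (Start \<alpha> P) \<and> s [] = Point p) \<longleftrightarrow>
    p \<in> dom P \<and> winning_position (Instance_Played \<alpha> P p)"
proof
  assume "\<exists>s. winning_strategy s (Start \<alpha> P) \<and> s [] = Point p"
  then obtain s where s: "winning_strategy s (Start \<alpha> P)" "s [] = Point p" by blast
  have ex: "\<exists>m S'. legal_move S m S' \<and> (player1_to_move S \<longrightarrow> m = s h)"
    if S: "play s (Start \<alpha> P) h S" "\<not> player1_won S" for h S
  proof -
    obtain m S' where "play s (Start \<alpha> P) (h @ [m]) S'"
      using s(1) S unfolding winning_strategy_def by blast
    then obtain T where "play s (Start \<alpha> P) h T" "player1_to_move T \<longrightarrow> m = s h" "legal_move T m S'"
      unfolding play_snoc_iff by blast
    moreover then have "T = S"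
      using S(1) play_reaches reaches_deterministic by blast
    ultimately show ?thesis by blast
  qed
  have win: "winning_position S" if "play s (Start \<alpha> P) h S" for h S
    using wf_legal_move that
  proof (induction S arbitrary: h rule: wf_induct_rule)
    case (less S)
    show ?case
    proof (cases "player1_to_move S")
      case True
      then have "\<not> player1_won S" by (auto simp: player1_won_def)
      then obtain S' where S': "legal_move S (s h) S'" using ex[OF less.prems] True by blast
      then have "play s (Start \<alpha> P) (h @ [s h]) S'" using less.prems play_snoc_iff by blast
      then have "winning_position S'" using less.IH S' by blast
      then show ?thesis using winning_position.player1 True S' by blast
    next
      case False
      show ?thesis
      proof (rule winning_position.player2[OF False])
        fix m S' assume S': "legal_move S m S'"
        then have "play s (Start \<alpha> P) (h @ [m]) S'" using less.prems False play_snoc_iff by blast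
        then show "winning_position S'" using less.IH S' by blast
      qed
    qed
  qed
  have start: "play s (Start \<alpha> P) [] (Start \<alpha> P)" by (rule play.intros)
  moreover have "\<not> player1_won (Start \<alpha> P)" by (simp add: player1_won_def)
  ultimately obtain S' where S': "legal_move (Start \<alpha> P) (Point p) S'"
    using ex[of "[]" "Start \<alpha> P"] s(2) by auto
  then have "play s (Start \<alpha> P) ([] @ [Point p]) S'"
    unfolding play_snoc_iff using start s(2) by auto
  then have "winning_position S'" by (rule win)
  then show "p \<in> dom P \<and> winning_position (Instance_Played \<alpha> P p)"
    using S' by (auto simp: legal_move.simps)
next
  assume p: "p \<in> dom P \<and> winning_position (Instance_Played \<alpha> P p)"
  \<comment> \<open>The strategy replays the history and picks a move into the set of winning positions.\<close>
  define good where "good h m \<longleftrightarrow>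
    (\<exists>S S'. reaches (Start \<alpha> P) h S \<and> legal_move S m S' \<and> winning_position S')" for h m
  define s where "s h = (if h = [] then Point p else SOME m. good h m)" for h
  have good: "\<exists>S'. legal_move S (s h) S' \<and> winning_position S'"
    if S: "play s (Start \<alpha> P) h S" "player1_to_move S" "winning_position S" for h S
  proof (cases "h = []")
    case True
    then have "S = Start \<alpha> P" using play_reaches[OF S(1)] by simp
    then show ?thesis using True p by (auto simp: s_def legal_move.simps)
  next
    case False
    have "reaches (Start \<alpha> P) h S" using S(1) by (rule play_reaches)
    moreover then have "\<exists>m. good h m"
      using S(2,3) winning_position_player1_iff unfolding good_def by blast
    then have "good h (s h)" using False unfolding s_def by (simp add: someI_ex)
    ultimately show ?thesis using reaches_deterministic unfolding good_def by blast
  qed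
  have win: "winning_position S" if "play s (Start \<alpha> P) h S" for h S
    using that
  proof (induction rule: play.induct)
    case 1
    then show ?case using p winning_position_Start by blast
  next
    case (2 h S S')
    then show ?case using good legal_move_deterministic by blast
  next
    case (3 h S m S')
    then show ?case using winning_position_player2_iff by blast
  qed
  have "player1_won S"
    if S: "play s (Start \<alpha> P) h S" "\<nexists>m S'. play s (Start \<alpha> P) (h @ [m]) S'" for h S
  proof -
    have "\<not> player1_to_move S"
      using good[OF S(1)] win[OF S(1)] S play_snoc_iff by blast
    moreover then have "\<not> legal_move S m S'" for m S'
      using S play_snoc_iff by blast
    ultimately show ?thesis
      by (cases S) (auto simp: player1_won_def legal_move.simps initial_segment_iff)
  qed
  then show "\<exists>s. winning_strategy s (Start \<alpha> P) \<and> s [] = Point p"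
    unfolding winning_strategy_def by (intro exI[of _ s]) (auto simp: s_def)
qed

lemma game_iff_wins:
  "(\<exists>s. winning_strategy s (Start \<alpha> P) \<and> s [] = Point p) \<longleftrightarrow> wins \<alpha> P p"
  unfolding ex_winning_strategy_iff using winning_position_iff_wins wins_dom by blast


section \<open>Reductions by total functions\<close>

text \<open>
  Only the values on the instances and on the pairs that a reduction has to handle matter, so partial functions
  can be replaced by total ones that are continuous on these sets.
\<close>

definition weihrauch_total ::
    "problem \<Rightarrow> problem \<Rightarrow> (baire \<Rightarrow> baire) \<Rightarrow> (baire \<times> baire \<Rightarrow> baire) \<Rightarrow> bool"
  where "weihrauch_total P Q \<phi> \<psi> \<longleftrightarrow>
    continuous_on (dom P) \<phi> \<and>
    continuous_on {(x, q). x \<in> dom P \<and> q \<in> the (Q (\<phi> x))} \<psi> \<and>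
    (\<forall>x\<in>dom P. \<phi> x \<in> dom Q \<and> (\<forall>q\<in>the (Q (\<phi> x)). \<psi> (x, q) \<in> the (P x)))"

lemma weihrauch_via_imp_total:
  assumes "weihrauch_via P Q \<Phi> \<Psi>"
  shows "weihrauch_total P Q (\<lambda>x. the (\<Phi> x)) (\<lambda>z. the (\<Psi> z))"
proof -
  have c: "continuous_on (dom \<Phi>) (\<lambda>x. the (\<Phi> x))" "continuous_on (dom \<Psi>) (\<lambda>x. the (\<Psi> x))"
    and r: "\<forall>p\<in>dom P. \<exists>x\<in>dom Q. \<Phi> p = Some x \<and> (\<forall>q\<in>the (Q x). \<exists>y\<in>the (P p). \<Psi> (p, q) = Some y)"
    using assms unfolding weihrauch_via_def continuous_partial_def by simp_all
  have \<Phi>: "x \<in> dom \<Phi> \<and> the (\<Phi> x) \<in> dom Q" if x: "x \<in> dom P" for x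
  proof -
    obtain y where "y \<in> dom Q" "\<Phi> x = Some y" using bspec[OF r x] by blast
    then show ?thesis by auto
  qed
  have \<Psi>: "(x, q) \<in> dom \<Psi> \<and> the (\<Psi> (x, q)) \<in> the (P x)"
    if x: "x \<in> dom P" and q: "q \<in> the (Q (the (\<Phi> x)))" for x q
  proof -
    obtain z where "\<Phi> x = Some z" "\<forall>q\<in>the (Q z). \<exists>y\<in>the (P x). \<Psi> (x, q) = Some y"
      using bspec[OF r x] by blast
    then obtain y where "y \<in> the (P x)" "\<Psi> (x, q) = Some y" using q by auto
    then show ?thesis by auto
  qed
  show ?thesis
    unfolding weihrauch_total_def
    by (intro conjI continuous_on_subset[OF c(1)] continuous_on_subset[OF c(2)] ballI)
      (use \<Phi> \<Psi> in blast)+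
qed

lemma weihrauch_total_imp_via:
  assumes "weihrauch_total P Q \<phi> \<psi>" "x\<^sub>0 \<in> dom P"
  shows "\<exists>\<Phi> \<Psi>. weihrauch_via P Q \<Phi> \<Psi> \<and> \<Phi> x\<^sub>0 = Some (\<phi> x\<^sub>0)"
proof -
  let ?D = "{(x, q). x \<in> dom P \<and> q \<in> the (Q (\<phi> x))}"
  define \<Phi> where "\<Phi> x = (if x \<in> dom P then Some (\<phi> x) else None)" for x
  define \<Psi> where "\<Psi> z = (if z \<in> ?D then Some (\<psi> z) else None)" for z
  have dom: "dom \<Phi> = dom P" "dom \<Psi> = ?D"
    unfolding set_eq_iff domIff \<Phi>_def \<Psi>_def by auto
  have \<Phi>: "\<Phi> x = Some (\<phi> x)" if "x \<in> dom P" for x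
    using that by (simp only: \<Phi>_def if_True)
  have \<Psi>: "\<Psi> z = Some (\<psi> z)" if "z \<in> ?D" for z
    using that by (simp only: \<Psi>_def if_True)
  have "continuous_on (dom P) \<phi>" "continuous_on ?D \<psi>"
    using assms(1) unfolding weihrauch_total_def by simp_all
  moreover have "\<phi> x = the (\<Phi> x)" if "x \<in> dom P" for x unfolding \<Phi>[OF that] by simp
  moreover have "\<psi> z = the (\<Psi> z)" if "z \<in> ?D" for z unfolding \<Psi>[OF that] by simp
  ultimately have "continuous_on (dom P) (\<lambda>x. the (\<Phi> x))" "continuous_on ?D (\<lambda>z. the (\<Psi> z))"
    by (blast intro: continuous_on_eq)+
  then have "continuous_partial \<Phi>" "continuous_partial \<Psi>"
    unfolding continuous_partial_def dom by simp_all
  moreover have "\<exists>y\<in>dom Q. \<Phi> x = Some y \<and> (\<forall>q\<in>the (Q y). \<exists>z\<in>the (P x). \<Psi> (x, q) = Some z)"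
    if x: "x \<in> dom P" for x
  proof -
    have "\<phi> x \<in> dom Q" "\<forall>q\<in>the (Q (\<phi> x)). \<psi> (x, q) \<in> the (P x)"
      using assms(1) x unfolding weihrauch_total_def by blast+
    moreover have "\<Psi> (x, q) = Some (\<psi> (x, q))" if "q \<in> the (Q (\<phi> x))" for q
      using x that by (intro \<Psi>) simp
    ultimately show ?thesis using \<Phi>[OF x] by blast
  qed
  ultimately have "weihrauch_via P Q \<Phi> \<Psi>" unfolding weihrauch_via_def by blast
  then show ?thesis using \<Phi>[OF assms(2)] by blast
qed

lemma weihrauch_via_iff_total:
  assumes "x\<^sub>0 \<in> dom P"
  shows "(\<exists>\<Phi> \<Psi>. weihrauch_via P Q \<Phi> \<Psi> \<and> \<Phi> x\<^sub>0 = Some p) \<longleftrightarrow>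
    (\<exists>\<phi> \<psi>. weihrauch_total P Q \<phi> \<psi> \<and> \<phi> x\<^sub>0 = p)"
proof
  assume "\<exists>\<Phi> \<Psi>. weihrauch_via P Q \<Phi> \<Psi> \<and> \<Phi> x\<^sub>0 = Some p"
  then obtain \<Phi> \<Psi> where w: "weihrauch_via P Q \<Phi> \<Psi>" "\<Phi> x\<^sub>0 = Some p" by blast
  have "the (\<Phi> x\<^sub>0) = p" using w(2) by simp
  with weihrauch_via_imp_total[OF w(1)]
  show "\<exists>\<phi> \<psi>. weihrauch_total P Q \<phi> \<psi> \<and> \<phi> x\<^sub>0 = p"
    by (intro exI[of _ "\<lambda>x. the (\<Phi> x)"] exI[of _ "\<lambda>z. the (\<Psi> z)"] conjI)
next
  assume "\<exists>\<phi> \<psi>. weihrauch_total P Q \<phi> \<psi> \<and> \<phi> x\<^sub>0 = p"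
  then show "\<exists>\<Phi> \<Psi>. weihrauch_via P Q \<Phi> \<Psi> \<and> \<Phi> x\<^sub>0 = Some p"
    using weihrauch_total_imp_via assms by blast
qed


section \<open>Instances and solutions of \<open>ACC\<close>\<close>

lemma rank_witnessing_representation_le:
  "rank_witnessing_representation \<alpha> L \<Longrightarrow> \<beta> \<le> \<alpha> \<Longrightarrow> rank_witnessing_representation \<beta> L"
  unfolding rank_witnessing_representation_def by (meson order_trans)

lemma rank_witnessing_representationD:
  assumes "rank_witnessing_representation \<alpha> L" "0 < \<alpha>"
  shows "L \<alpha> j < \<alpha>" "i \<le> j \<Longrightarrow> L \<alpha> i \<le> L \<alpha> j" "\<gamma> < \<alpha> \<Longrightarrow> \<exists>i. \<gamma> \<le> L \<alpha> i"
proof -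
  have "rank_witnessing \<alpha> (L \<alpha>)" using assms unfolding rank_witnessing_representation_def by blast
  then show "L \<alpha> j < \<alpha>" "i \<le> j \<Longrightarrow> L \<alpha> i \<le> L \<alpha> j" "\<gamma> < \<alpha> \<Longrightarrow> \<exists>i. \<gamma> \<le> L \<alpha> i"
    unfolding rank_witnessing_def by (blast dest: monoD)+
qed

lemma hashes_num_nth:
  "(hashes_num j n \<frown> w) i = (if i < j then hash else if i = j then Suc n else w (i - Suc j))"
  by (auto simp: hashes_num_def conc_def nth_append)

lemma length_hashes_num [simp]: "length (hashes_num j n) = Suc j"
  by (simp add: hashes_num_def)

lemma num_hashes_nth:
  "(num_hashes n k \<frown> y) i = (if i = 0 then Suc n else if i \<le> k then hash else y (i - Suc k))"
  unfolding num_hashes_def by (cases i) (simp_all only: build_cons build.simps, auto simp: conc_def)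

lemma hash_omega_nth [simp]: "hash_omega i = hash"
  by (simp add: hash_omega_def)

lemma mem_nbhd_hash_omega: "x \<in> nbhd k hash_omega \<longleftrightarrow> (\<forall>i<k. x i = hash)"
  by (simp add: mem_nbhd)

lemma hashes_num_in_nbhd: "hashes_num j n \<frown> w \<in> nbhd k hash_omega \<longleftrightarrow> k \<le> j"
  unfolding mem_nbhd_hash_omega hashes_num_nth by (auto simp: not_le)

lemma hash_omega_in_dom_ACC [simp]: "hash_omega \<in> dom (ACC L \<alpha>)"
  by (simp add: ACC_def dom_def acc_instance.intros(1))

lemma hashes_num_in_dom_ACC:
  "0 < \<alpha> \<Longrightarrow> hashes_num j n \<frown> w \<in> dom (ACC L \<alpha>) \<longleftrightarrow> w \<in> dom (ACC L (L \<alpha> j))"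
  by (subst dom_ACC) auto

lemma dom_ACC_cases:
  assumes "x \<in> dom (ACC L \<alpha>)" "0 < \<alpha>"
  obtains "x = hash_omega"
  | j n w where "x = hashes_num j n \<frown> w" "w \<in> dom (ACC L (L \<alpha> j))"
  using assms(1) unfolding dom_ACC[OF assms(2)] by blast

text \<open>
  A solution never starts with hash.  Hence in a solution \<open>num_hashes n k \<frown> y\<close> the end
  of the hashes, and with it \<open>y\<close>, can be recognised.
\<close>

lemma ACC_solution_first:
  assumes "y \<in> the (ACC L \<alpha> x)" "x \<in> dom (ACC L \<alpha>)"
  shows "y 0 \<noteq> hash"
proof -
  have "acc_solution L \<alpha> x y"
    using assms by (auto simp: ACC_def split: if_splits)
  then show ?thesis
    by cases (simp_all add: num_hashes_def)
qed

lemma conc_in_nbhd: "w' \<in> nbhd k w \<Longrightarrow> \<sigma> \<frown> w' \<in> nbhd (length \<sigma> + k) (\<sigma> \<frown> w)"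
  by (auto simp: mem_nbhd conc_def)

lemma continuous_on_conc: "continuous_on S (\<lambda>w :: baire. \<sigma> \<frown> w)"
  unfolding continuous_on_baire_iff
proof (intro ballI allI)
  fix w n
  have "\<sigma> \<frown> w' \<in> nbhd n (\<sigma> \<frown> w)" if "w' \<in> nbhd n w" for w'
    using conc_in_nbhd[OF that, of \<sigma>] nbhd_antimono[of n "length \<sigma> + n" "\<sigma> \<frown> w"] by auto
  then show "\<exists>k. \<forall>w'\<in>S \<inter> nbhd k w. \<sigma> \<frown> w' \<in> nbhd n (\<sigma> \<frown> w)" by blast
qed

text \<open>
  On sequences \<open>y\<close> that do not start with hash, this inverts \<open>num_hashes n k \<frown> y\<close> for all \<open>n\<close> and
  \<open>k\<close> at once.
\<close>

definition strip :: "baire \<Rightarrow> baire"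
  where "strip z = suffix (LEAST i. 0 < i \<and> z i \<noteq> hash) z"

lemma strip_num_hashes: "y 0 \<noteq> hash \<Longrightarrow> strip (num_hashes n k \<frown> y) = y"
proof -
  assume y: "y 0 \<noteq> hash"
  let ?z = "num_hashes n k \<frown> y"
  have "(LEAST i. 0 < i \<and> ?z i \<noteq> hash) = Suc k"
    by (rule Least_equality) (use y in \<open>auto simp: num_hashes_nth split: if_splits\<close>)
  then show ?thesis
    unfolding strip_def by (intro ext) (simp add: num_hashes_nth)
qed

lemma continuous_on_strip: "continuous_on {z. \<exists>i>0. z i \<noteq> hash} strip"
  unfolding continuous_on_baire_iff
proof (intro ballI allI)
  fix z :: baire and n assume "z \<in> {z. \<exists>i>0. z i \<noteq> hash}"
  then have ex: "\<exists>i. 0 < i \<and> z i \<noteq> hash" by blast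
  define m where "m = (LEAST i. 0 < i \<and> z i \<noteq> hash)"
  have m: "0 < m" "z m \<noteq> hash" using LeastI_ex[OF ex] by (simp_all add: m_def)
  have min: "z i = hash" if "0 < i" "i < m" for i
    using not_less_Least[of i "\<lambda>i. 0 < i \<and> z i \<noteq> hash"] that by (simp add: m_def)
  have "strip z' \<in> nbhd n (strip z)" if z': "z' \<in> nbhd (Suc m + n) z" for z'
  proof -
    have eq: "z' i = z i" if "i < Suc m + n" for i using z' that unfolding mem_nbhd by blast
    have "(LEAST i. 0 < i \<and> z' i \<noteq> hash) = m"
    proof (rule Least_equality)
      show "0 < m \<and> z' m \<noteq> hash" using m eq by simp
      show "m \<le> i" if "0 < i \<and> z' i \<noteq> hash" for i
        using that min[of i] eq[of i] by (cases "i < m") auto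
    qed
    then show ?thesis unfolding strip_def m_def[symmetric] mem_nbhd suffix_nth using eq by simp
  qed
  then show "\<exists>k. \<forall>z'\<in>{z. \<exists>i>0. z i \<noteq> hash} \<inter> nbhd k z. strip z' \<in> nbhd n (strip z)" by blast
qed


section \<open>From reductions to wins\<close>

text \<open>
  The answer to \<open>hash_omega\<close> and \<open>q\<close> starts with some number \<open>m\<close>, and this still holds for instances and
  solutions that agree with them up to some \<open>l\<close>; Player 1 imposes the first \<open>l\<close> letters of \<open>q\<close>.  For \<open>j\<close>
  large, instances \<open>hashes_num j m \<frown> w\<close> are mapped close to \<open>p\<close>.  They forbid \<open>m\<close>, while the
  answers still start with \<open>m\<close>, so the answers must contain solutions of \<open>w\<close>.  Thus the problem of rank \<open>L \<alpha> j\<close>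
  is reduced to the restricted problem and the induction hypothesis applies.
\<close>

lemma ACC_reduction_imp_wins:
  "rank_witnessing_representation \<alpha> L \<Longrightarrow> weihrauch_total (ACC L \<alpha>) P \<phi> \<psi> \<Longrightarrow>
    wins \<alpha> P (\<phi> hash_omega)"
proof (induction \<alpha> arbitrary: P \<phi> \<psi> rule: less_induct)
  case (less \<alpha>)
  define p where "p = \<phi> hash_omega"
  let ?D = "{(x, q). x \<in> dom (ACC L \<alpha>) \<and> q \<in> the (P (\<phi> x))}"
  have \<phi>: "continuous_on (dom (ACC L \<alpha>)) \<phi>" and \<psi>: "continuous_on ?D \<psi>"
    and red: "\<And>x. x \<in> dom (ACC L \<alpha>) \<Longrightarrow> \<phi> x \<in> dom P"
      "\<And>x q. x \<in> dom (ACC L \<alpha>) \<Longrightarrow> q \<in> the (P (\<phi> x)) \<Longrightarrow> \<psi> (x, q) \<in> the (ACC L \<alpha> x)"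
    using less.prems(2) unfolding weihrauch_total_def by blast+
  have "wins \<alpha> P p"
  proof (rule wins.intros)
    show "p \<in> dom P" unfolding p_def by (rule red) simp
    fix q assume q: "q \<in> the (P p)"
    then have sol: "\<psi> (hash_omega, q) \<in> the (ACC L \<alpha> hash_omega)"
      unfolding p_def by (intro red) simp_all
    then have "\<alpha> \<noteq> 0" by (auto simp: ACC_0)
    then have pos: "0 < \<alpha>" by (simp add: zero_less_omega1_iff)
    obtain m y where m: "\<psi> (hash_omega, q) = Suc m ## y"
      using sol unfolding ACC_hash_omega[OF pos] by auto
    have "(hash_omega, q) \<in> ?D" using q p_def by simp
    then obtain l where l: "\<And>x' q'. (x', q') \<in> ?D \<Longrightarrow> x' \<in> nbhd l hash_omega \<Longrightarrow> q' \<in> nbhd l q \<Longrightarrow>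
        \<psi> (x', q') \<in> nbhd 1 (\<psi> (hash_omega, q))"
      using \<psi> unfolding continuous_on_baire_pair_iff by meson
    have "\<exists>\<gamma><\<alpha>. \<exists>p'. wins \<gamma> (restrict_problem P (nbhd k p) (nbhd l q)) p'" for k
    proof -
      let ?Q = "restrict_problem P (nbhd k p) (nbhd l q)"
      obtain k' where k': "\<forall>x\<in>dom (ACC L \<alpha>) \<inter> nbhd k' hash_omega. \<phi> x \<in> nbhd k p"
        using \<phi> hash_omega_in_dom_ACC[of L \<alpha>] unfolding continuous_on_baire_iff p_def by blast
      \<comment> \<open>After \<open>k'\<close> hashes the forward function stays in the neighbourhood that Player 2 chose; after \<open>l\<close>
        hashes the first number of the answer is \<open>m\<close>.\<close>
      define j where "j = max k' l"
      let ?\<gamma> = "L \<alpha> j"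
      define c where "c w = hashes_num j m \<frown> w" for w
      have \<gamma>: "?\<gamma> < \<alpha>" using rank_witnessing_representationD[OF less.prems(1) pos] by blast
      have c: "c w \<in> dom (ACC L \<alpha>) \<and> c w \<in> nbhd k' hash_omega \<and> c w \<in> nbhd l hash_omega"
        if "w \<in> dom (ACC L ?\<gamma>)" for w
        using that pos by (simp add: c_def hashes_num_in_dom_ACC hashes_num_in_nbhd j_def)
      have \<phi>c: "\<phi> (c w) \<in> dom P \<inter> nbhd k p" if "w \<in> dom (ACC L ?\<gamma>)" for w
        using c[OF that] red(1) k' by blast
      have sol: "\<exists>i y. \<psi> (c w, q') = num_hashes m i \<frown> y \<and> y \<in> the (ACC L ?\<gamma> w)"
        if w: "w \<in> dom (ACC L ?\<gamma>)" and q': "q' \<in> the (?Q (\<phi> (c w)))" for w q'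
      proof -
        have q'': "q' \<in> the (P (\<phi> (c w)))" "q' \<in> nbhd l q"
          using q' \<phi>c[OF w] by (simp_all add: the_restrict_problem)
        then have "\<psi> (c w, q') \<in> nbhd 1 (\<psi> (hash_omega, q))"
          using c[OF w] by (intro l) simp_all
        then have first: "\<psi> (c w, q') 0 = Suc m" unfolding m mem_nbhd by simp
        have "\<psi> (c w, q') \<in> the (ACC L \<alpha> (c w))" using red(2) c[OF w] q''(1) by blast
        then show ?thesis
          using first unfolding c_def ACC_hashes_num[OF pos w] by auto
      qed
      let ?\<phi> = "\<lambda>w. \<phi> (c w)" and ?\<psi> = "\<lambda>z. strip (\<psi> (c (fst z), snd z))"
      let ?E = "{(w, q'). w \<in> dom (ACC L ?\<gamma>) \<and> q' \<in> the (?Q (\<phi> (c w)))}"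
      have cont_c: "continuous_on S c" for S unfolding c_def by (rule continuous_on_conc)
      have "continuous_on (dom (ACC L ?\<gamma>)) ?\<phi>"
        by (rule continuous_on_compose2[OF \<phi> cont_c]) (use c in blast)
      moreover have "continuous_on ?E ?\<psi>"
      proof (rule continuous_on_compose2[OF continuous_on_strip])
        have "continuous_on ?E (\<lambda>z. (c (fst z), snd z))"
          by (intro continuous_on_Pair continuous_on_compose2[OF cont_c[of UNIV] continuous_on_fst]
              continuous_on_snd continuous_on_id subset_UNIV)
        then show "continuous_on ?E (\<lambda>z. \<psi> (c (fst z), snd z))"
        proof (rule continuous_on_compose2[OF \<psi>])
          show "(\<lambda>z. (c (fst z), snd z)) ` ?E \<subseteq> ?D"
          proof (rule image_subsetI)
            fix z assume "z \<in> ?E"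
            then have "fst z \<in> dom (ACC L ?\<gamma>)" "snd z \<in> the (?Q (\<phi> (c (fst z))))"
              by (simp_all add: case_prod_beta)
            then show "(c (fst z), snd z) \<in> ?D"
              using c \<phi>c the_restrict_problem[of "\<phi> (c (fst z))" P "nbhd k p" "nbhd l q"] by simp
          qed
        qed
        show "(\<lambda>z. \<psi> (c (fst z), snd z)) ` ?E \<subseteq> {z. \<exists>i>0. z i \<noteq> hash}"
        proof clarsimp
          fix w q' S assume *: "ACC L ?\<gamma> w = Some S" "q' \<in> the (?Q (\<phi> (c w)))"
          then have w: "w \<in> dom (ACC L ?\<gamma>)" by blast
          obtain i y where y: "\<psi> (c w, q') = num_hashes m i \<frown> y" "y \<in> the (ACC L ?\<gamma> w)"
            using sol[OF w *(2)] by blast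
          have "y 0 \<noteq> hash" using y(2) w by (rule ACC_solution_first)
          then have "0 < Suc i \<and> \<psi> (c w, q') (Suc i) \<noteq> hash" by (simp add: y(1) num_hashes_nth)
          then show "\<exists>i>0. 0 < \<psi> (c w, q') i" by blast
        qed
      qed
      moreover have "\<phi> (c w) \<in> dom ?Q \<and> (\<forall>q'\<in>the (?Q (\<phi> (c w))). ?\<psi> (w, q') \<in> the (ACC L ?\<gamma> w))"
        if w: "w \<in> dom (ACC L ?\<gamma>)" for w
      proof (intro conjI ballI)
        show "\<phi> (c w) \<in> dom ?Q" using \<phi>c[OF w] by simp
        fix q' assume "q' \<in> the (?Q (\<phi> (c w)))"
        then obtain i y where y: "\<psi> (c w, q') = num_hashes m i \<frown> y" "y \<in> the (ACC L ?\<gamma> w)"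
          using sol[OF w] by blast
        have "y 0 \<noteq> hash" using y(2) w by (rule ACC_solution_first)
        then show "?\<psi> (w, q') \<in> the (ACC L ?\<gamma> w)" using y by (simp add: strip_num_hashes)
      qed
      ultimately have "weihrauch_total (ACC L ?\<gamma>) ?Q ?\<phi> ?\<psi>"
        unfolding weihrauch_total_def by blast
      then have "wins ?\<gamma> ?Q (\<phi> (c hash_omega))"
        by (rule less.IH[OF \<gamma> rank_witnessing_representation_le[OF less.prems(1) less_imp_le[OF \<gamma>]]])
      then show ?thesis using \<gamma> by blast
    qed
    then show "\<exists>l. \<forall>k. \<exists>\<gamma><\<alpha>. \<exists>p'. wins \<gamma> (restrict_problem P (nbhd k p) (nbhd l q)) p'" by blast
  qed
  then show ?case unfolding p_def .
qed


section \<open>From wins to reductions\<close>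

text \<open>
  Definition by cases on an instance of \<open>ACC\<close>: it is \<open>hash_omega\<close> or has the form
  \<open>hashes_num j n \<frown> w\<close>.
\<close>

definition acc_case :: "'a \<Rightarrow> (nat \<Rightarrow> nat \<Rightarrow> baire \<Rightarrow> 'a) \<Rightarrow> baire \<Rightarrow> 'a"
  where "acc_case a f x =
    (if x = hash_omega then a
     else let j = LEAST i. x i \<noteq> hash in f j (x j - 1) (suffix (Suc j) x))"

lemma acc_case_hash_omega [simp]: "acc_case a f hash_omega = a"
  by (simp add: acc_case_def)

lemma acc_case_hashes_num [simp]: "acc_case a f (hashes_num j n \<frown> w) = f j n w"
proof -
  have "(LEAST i. (hashes_num j n \<frown> w) i \<noteq> hash) = j"
    by (rule Least_equality) (auto simp: hashes_num_nth split: if_splits)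
  moreover have "suffix (Suc j) (hashes_num j n \<frown> w) = w"
    using suffix_conc_length[of "hashes_num j n" w] by simp
  ultimately show ?thesis by (simp add: acc_case_def hashes_num_nth)
qed

lemma nbhd_hashes_num:
  assumes "x' \<in> nbhd (Suc j + k) (hashes_num j n \<frown> w)"
  obtains w' where "x' = hashes_num j n \<frown> w'" "w' \<in> nbhd k w"
proof
  let ?x = "hashes_num j n \<frown> w"
  have eq: "x' i = ?x i" if "i < Suc j + k" for i using assms that unfolding mem_nbhd by blast
  show "x' = hashes_num j n \<frown> suffix (Suc j) x'"
  proof
    fix i show "x' i = (hashes_num j n \<frown> suffix (Suc j) x') i"
      using eq[of i] by (auto simp: hashes_num_nth)
  qed
  show "suffix (Suc j) x' \<in> nbhd k w"
    unfolding mem_nbhd suffix_nth using eq by (auto simp: hashes_num_nth)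
qed

lemma num_hashes_in_nbhd:
  assumes "k \<le> Suc j"
  shows "num_hashes n j \<frown> y \<in> nbhd k (Suc n ## hash_omega)"
  unfolding mem_nbhd
proof (intro allI impI)
  fix i assume "i < k"
  then show "(num_hashes n j \<frown> y) i = (Suc n ## hash_omega) i"
    using assms by (cases i) (simp_all add: num_hashes_nth)
qed

lemma cylinder_nbhd_iff:
  "q' \<in> nbhd N q \<Longrightarrow> length \<sigma> \<le> N \<Longrightarrow> q' \<in> cylinder \<sigma> \<longleftrightarrow> q \<in> cylinder \<sigma>"
  unfolding mem_nbhd mem_cylinder_nth[of _ \<sigma>] by (metis less_le_trans)

text \<open>
  Data from which a reduction of \<open>ACC L \<alpha>\<close> to \<open>P\<close> is glued.  The segments that Player 1 may impose on
  solutions of \<open>p\<close> are numbered by \<open>\<rho>\<close>.  If \<open>active j n\<close> holds, then after \<open>j\<close> hashes the number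
  \<open>n\<close> can be served: the problem of rank \<open>L \<alpha> j\<close> reduces to \<open>P\<close> restricted to the first \<open>d j n\<close> letters of
  \<open>p\<close> and to the segment \<open>\<rho> n\<close>.  The condition on \<open>d\<close> is uniform in \<open>n\<close> because the forward function has to be
  continuous at \<open>hash_omega\<close>, where \<open>n\<close> is still unknown.
\<close>

locale ACC_gluing =
  fixes L :: "omega1 \<Rightarrow> nat \<Rightarrow> omega1" and \<alpha> :: omega1 and P :: problem and p :: baire
    and active :: "nat \<Rightarrow> nat \<Rightarrow> bool" and d :: "nat \<Rightarrow> nat \<Rightarrow> nat" and \<rho> :: "nat \<Rightarrow> nat list"
    and f :: "nat \<Rightarrow> nat \<Rightarrow> baire \<Rightarrow> baire" and g :: "nat \<Rightarrow> nat \<Rightarrow> baire \<times> baire \<Rightarrow> baire"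
  assumes pos: "0 < \<alpha>" and p: "p \<in> dom P"
    and active_le: "active j n \<Longrightarrow> n \<le> j"
    and active_mono: "active j n \<Longrightarrow> j \<le> j' \<Longrightarrow> active j' n"
    and covered: "q \<in> the (P p) \<Longrightarrow> \<exists>n j. active j n \<and> q \<in> cylinder (\<rho> n)"
    and depth: "\<exists>J. \<forall>j\<ge>J. \<forall>n. active j n \<longrightarrow> K \<le> d j n"
    and reduction: "active j n \<Longrightarrow> weihrauch_total (ACC L (L \<alpha> j))
      (restrict_problem P (nbhd (d j n) p) (cylinder (\<rho> n))) (f j n) (g j n)"
begin

abbreviation piece :: "nat \<Rightarrow> nat \<Rightarrow> problem"
  where "piece j n \<equiv> restrict_problem P (nbhd (d j n) p) (cylinder (\<rho> n))"

text \<open>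
  An inactive pair is sent to \<open>p\<close> itself; the backward function then never uses the forbidden number \<open>n\<close>
  and so needs no information from the rest of the instance.
\<close>

definition forward :: "baire \<Rightarrow> baire"
  where "forward = acc_case p (\<lambda>j n w. if active j n then f j n w else p)"

text \<open>
  The backward function answers with the least number of an active segment of \<open>q\<close>.  For the instance
  \<open>hash_omega\<close>, the numbers that become active eventually take this role.
\<close>

definition selected :: "nat \<Rightarrow> baire \<Rightarrow> nat \<Rightarrow> bool"
  where "selected j q m \<longleftrightarrow> active j m \<and> q \<in> cylinder (\<rho> m)"

definition limit_selected :: "baire \<Rightarrow> nat \<Rightarrow> bool"
  where "limit_selected q m \<longleftrightarrow> (\<exists>j. active j m) \<and> q \<in> cylinder (\<rho> m)"

text \<open>
  The answer is a number followed by hashes.  Only if that number is the forbidden \<open>n\<close> is it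
  followed by a solution of \<open>w\<close>, obtained from the reduction for \<open>(j, n)\<close>.  That solution is delayed by
  \<open>j\<close> hashes so that the answers converge as \<open>j\<close> grows.  If no segment is recognised, then any
  number other than \<open>n\<close> is a correct answer, for instance \<open>n + 1\<close>.
\<close>

definition backward :: "baire \<times> baire \<Rightarrow> baire"
  where "backward = (\<lambda>(x, q). acc_case
    (Suc (LEAST m. limit_selected q m) ## hash_omega)
    (\<lambda>j n w.
      if \<exists>m. selected j q m then
        if (LEAST m. selected j q m) = n then num_hashes n j \<frown> g j n (w, q)
        else Suc (LEAST m. selected j q m) ## hash_omega
      else Suc (Suc n) ## hash_omega) x)"

lemma forward_simps:
  "forward hash_omega = p"
  "forward (hashes_num j n \<frown> w) = (if active j n then f j n w else p)"
  by (simp_all add: forward_def)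

lemma backward_simps:
  "backward (hash_omega, q) = Suc (LEAST m. limit_selected q m) ## hash_omega"
  "backward (hashes_num j n \<frown> w, q) =
    (if \<exists>m. selected j q m then
       if (LEAST m. selected j q m) = n then num_hashes n j \<frown> g j n (w, q)
       else Suc (LEAST m. selected j q m) ## hash_omega
     else Suc (Suc n) ## hash_omega)"
  by (simp_all add: backward_def)

lemma active_reduction:
  assumes "active j n"
  shows "continuous_on (dom (ACC L (L \<alpha> j))) (f j n)"
    and "continuous_on {(w, q). w \<in> dom (ACC L (L \<alpha> j)) \<and> q \<in> the (piece j n (f j n w))} (g j n)"
    and "\<And>w. w \<in> dom (ACC L (L \<alpha> j)) \<Longrightarrow> f j n w \<in> dom P \<inter> nbhd (d j n) p"
    and "\<And>w q. w \<in> dom (ACC L (L \<alpha> j)) \<Longrightarrow> q \<in> the (piece j n (f j n w)) \<Longrightarrow>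
      g j n (w, q) \<in> the (ACC L (L \<alpha> j) w)"
  using reduction[OF assms] unfolding weihrauch_total_def dom_restrict_problem by blast+

lemma forward_in_dom: "x \<in> dom (ACC L \<alpha>) \<Longrightarrow> forward x \<in> dom P"
proof (erule dom_ACC_cases[OF _ pos])
  show "x = hash_omega \<Longrightarrow> forward x \<in> dom P" using p by (simp only: forward_simps)
  fix j n w assume "x = hashes_num j n \<frown> w" "w \<in> dom (ACC L (L \<alpha> j))"
  then show "forward x \<in> dom P" using active_reduction(3) p by (simp add: forward_simps)
qed

lemma continuous_on_forward: "continuous_on (dom (ACC L \<alpha>)) forward"
  unfolding continuous_on_baire_iff
proof (intro ballI allI)
  fix x K assume "x \<in> dom (ACC L \<alpha>)"
  from this pos show "\<exists>k. \<forall>x'\<in>dom (ACC L \<alpha>) \<inter> nbhd k x. forward x' \<in> nbhd K (forward x)"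
  proof (cases rule: dom_ACC_cases)
    case x: 1
    obtain J where J: "\<forall>j\<ge>J. \<forall>n. active j n \<longrightarrow> K \<le> d j n" using depth by blast
    have "forward x' \<in> nbhd K p" if x': "x' \<in> dom (ACC L \<alpha>)" "x' \<in> nbhd J hash_omega" for x'
      using x'(1) pos
    proof (cases rule: dom_ACC_cases)
      case 1
      then show ?thesis by (simp add: forward_simps)
    next
      case (2 j n w)
      show ?thesis
      proof (cases "active j n")
        case True
        have "J \<le> j" using x'(2) unfolding 2(1) hashes_num_in_nbhd .
        then have "nbhd (d j n) p \<subseteq> nbhd K p" using J True by (intro nbhd_antimono) blast
        then show ?thesis using active_reduction(3)[OF True 2(2)] True by (auto simp: 2(1) forward_simps)
      next
        case False
        then show ?thesis by (simp add: 2(1) forward_simps)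
      qed
    qed
    then show ?thesis unfolding x forward_simps by blast
  next
    case x: (2 j n w)
    have "\<exists>k. \<forall>w'\<in>dom (ACC L (L \<alpha> j)) \<inter> nbhd k w.
        forward (hashes_num j n \<frown> w') \<in> nbhd K (forward (hashes_num j n \<frown> w))"
    proof (cases "active j n")
      case True
      then show ?thesis
        using active_reduction(1)[OF True] x(2) unfolding continuous_on_baire_iff
        by (simp only: forward_simps if_True)
    next
      case False
      then show ?thesis by (simp add: forward_simps)
    qed
    then obtain k where k: "\<And>w'. w' \<in> dom (ACC L (L \<alpha> j)) \<Longrightarrow> w' \<in> nbhd k w \<Longrightarrow>
        forward (hashes_num j n \<frown> w') \<in> nbhd K (forward (hashes_num j n \<frown> w))" by blast
    have "forward x' \<in> nbhd K (forward x)"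
      if x': "x' \<in> dom (ACC L \<alpha>)" "x' \<in> nbhd (Suc j + k) x" for x'
    proof -
      obtain w' where w': "x' = hashes_num j n \<frown> w'" "w' \<in> nbhd k w"
        using x'(2) unfolding x(1) by (rule nbhd_hashes_num)
      then have "w' \<in> dom (ACC L (L \<alpha> j))" using x'(1) hashes_num_in_dom_ACC[OF pos] by simp
      then show ?thesis using k w' by (simp only: x(1))
    qed
    then show ?thesis by blast
  qed
qed

lemma backward_solves:
  assumes "x \<in> dom (ACC L \<alpha>)" "q \<in> the (P (forward x))"
  shows "backward (x, q) \<in> the (ACC L \<alpha> x)"
  using assms(1) pos
proof (cases rule: dom_ACC_cases)
  case 1
  then show ?thesis by (auto simp: backward_simps ACC_hash_omega[OF pos])
next
  case (2 j n w)
  let ?m = "LEAST m. selected j q m"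
  have sols: "the (ACC L \<alpha> x) = {Suc m ## q | m q. m \<noteq> n} \<union>
      {num_hashes n k \<frown> y | k y. y \<in> the (ACC L (L \<alpha> j) w)}"
    unfolding 2(1) ACC_hashes_num[OF pos 2(2)] by simp
  show ?thesis
  proof (cases "\<exists>m. selected j q m")
    case ex: True
    show ?thesis
    proof (cases "?m = n")
      case True
      have "selected j q n" using LeastI_ex[OF ex] unfolding True .
      then have act: "active j n" and "q \<in> cylinder (\<rho> n)" by (simp_all add: selected_def)
      then have "q \<in> the (piece j n (f j n w))"
        using assms(2) active_reduction(3)[OF act 2(2)]
        by (simp add: 2(1) forward_simps the_restrict_problem)
      then have "g j n (w, q) \<in> the (ACC L (L \<alpha> j) w)" by (rule active_reduction(4)[OF act 2(2)])
      then show ?thesis unfolding sols unfolding 2(1) backward_simps if_P[OF ex] if_P[OF True] by blast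
    next
      case False
      then show ?thesis unfolding sols unfolding 2(1) backward_simps if_P[OF ex] if_not_P[OF False] by blast
    qed
  next
    case False
    have "Suc n \<noteq> n" by simp
    then show ?thesis unfolding sols unfolding 2(1) backward_simps if_not_P[OF False] by blast
  qed
qed

text \<open>
  Only the finitely many segments with numbers up to \<open>j\<close> can be active at \<open>j\<close>, so finitely many letters of
  \<open>q\<close> determine which of them are segments of \<open>q\<close>.
\<close>

lemma \<rho>_determined:
  assumes "q' \<in> nbhd N q" "(\<Sum>m\<le>j. length (\<rho> m)) \<le> N" "m \<le> j"
  shows "q' \<in> cylinder (\<rho> m) \<longleftrightarrow> q \<in> cylinder (\<rho> m)"
proof (rule cylinder_nbhd_iff[OF assms(1)])
  have "length (\<rho> m) \<le> (\<Sum>m\<le>j. length (\<rho> m))" by (rule member_le_sum) (use assms(3) in auto)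
  then show "length (\<rho> m) \<le> N" using assms(2) by simp
qed

text \<open>
  At \<open>(hash_omega, q)\<close>: the least segment \<open>m\<close> of \<open>q\<close> that is ever active is active from some \<open>J\<close> on, so after
  \<open>J\<close> hashes, and for all \<open>q'\<close> close enough to \<open>q\<close>, it is the selected one.  At
  \<open>(hashes_num j n \<frown> w, q)\<close> the numbers \<open>j\<close> and \<open>n\<close> are already visible and the selection depends on
  finitely many letters of \<open>q\<close>, so continuity is that of the reduction for \<open>(j, n)\<close>.
\<close>

lemma continuous_on_backward:
  "continuous_on {(x, q). x \<in> dom (ACC L \<alpha>) \<and> q \<in> the (P (forward x))} backward"
  (is "continuous_on ?D _")
  unfolding continuous_on_baire_pair_iff
proof (intro allI impI)
  fix x q K assume D: "(x, q) \<in> ?D"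
  then have "x \<in> dom (ACC L \<alpha>)" and q: "q \<in> the (P (forward x))" by auto
  from this(1) pos show "\<exists>k. \<forall>x' q'. (x', q') \<in> ?D \<longrightarrow> x' \<in> nbhd k x \<longrightarrow> q' \<in> nbhd k q \<longrightarrow>
      backward (x', q') \<in> nbhd K (backward (x, q))"
  proof (cases rule: dom_ACC_cases)
    case x: 1
    define m where "m = (LEAST m. limit_selected q m)"
    have "\<exists>m. limit_selected q m"
      using covered[of q] q unfolding x forward_simps limit_selected_def by blast
    then have m: "limit_selected q m" unfolding m_def by (rule LeastI_ex)
    have min: "m \<le> m'" if "limit_selected q m'" for m'
      unfolding m_def using that by (rule Least_le)
    obtain J where J: "active J m" using m by (auto simp: limit_selected_def)
    define k where "k = max (max J K) (\<Sum>i\<le>m. length (\<rho> i))"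
    have "backward (x', q') \<in> nbhd K (Suc m ## hash_omega)"
      if x': "x' \<in> dom (ACC L \<alpha>)" "x' \<in> nbhd k hash_omega" and q': "q' \<in> nbhd k q" for x' q'
    proof -
      have same: "q' \<in> cylinder (\<rho> i) \<longleftrightarrow> q \<in> cylinder (\<rho> i)" if "i \<le> m" for i
        by (rule \<rho>_determined[OF q' _ that]) (simp add: k_def)
      have least: "m \<le> i" if "limit_selected q' i" for i
        using min[of i] that same[of i] unfolding limit_selected_def by (cases "i \<le> m") auto
      from x'(1) pos show ?thesis
      proof (cases rule: dom_ACC_cases)
        case 1
        have "(LEAST i. limit_selected q' i) = m"
          by (rule Least_equality) (use m same least in \<open>auto simp: limit_selected_def\<close>)
        then show ?thesis unfolding 1 backward_simps by simp
      next
        case (2 j n w)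
        have "k \<le> j" using x'(2) unfolding 2(1) hashes_num_in_nbhd .
        then have j: "J \<le> j" "K \<le> j" by (simp_all add: k_def)
        have sel: "selected j q' m"
          using active_mono[OF J j(1)] m same[of m] by (simp add: selected_def limit_selected_def)
        have "(LEAST i. selected j q' i) = m"
          using sel by (rule Least_equality) (rule least, auto simp: selected_def limit_selected_def)
        moreover have ex: "\<exists>i. selected j q' i" using sel by blast
        moreover have "num_hashes m j \<frown> y \<in> nbhd K (Suc m ## hash_omega)" for y
          using j(2) by (intro num_hashes_in_nbhd) simp
        ultimately show ?thesis unfolding 2(1) backward_simps if_P[OF ex] by auto
      qed
    qed
    then show ?thesis unfolding x backward_simps m_def[symmetric] by blast
  next
    case x: (2 j n w)
    define N where "N = (\<Sum>i\<le>j. length (\<rho> i))"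
    have sel: "selected j q' = selected j q" if "q' \<in> nbhd N q" for q'
      using \<rho>_determined[OF that, of j] active_le[of j] unfolding selected_def N_def by (intro ext) auto
    have "\<exists>k\<ge>N. \<forall>w' q'. w' \<in> dom (ACC L (L \<alpha> j)) \<longrightarrow> q' \<in> the (P (forward (hashes_num j n \<frown> w'))) \<longrightarrow>
        w' \<in> nbhd k w \<longrightarrow> q' \<in> nbhd k q \<longrightarrow>
        backward (hashes_num j n \<frown> w', q') \<in> nbhd K (backward (hashes_num j n \<frown> w, q))"
    proof (cases "(\<exists>m. selected j q m) \<and> (LEAST m. selected j q m) = n")
      case True
      then have ex: "\<exists>m. selected j q m" and least: "(LEAST m. selected j q m) = n" by auto
      have "selected j q n" using LeastI_ex[OF ex] unfolding least .
      then have act: "active j n" by (simp add: selected_def)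
      let ?E = "{(w, q). w \<in> dom (ACC L (L \<alpha> j)) \<and> q \<in> the (piece j n (f j n w))}"
      have E: "(w', q') \<in> ?E"
        if "w' \<in> dom (ACC L (L \<alpha> j))" "q' \<in> the (P (forward (hashes_num j n \<frown> w')))" "q' \<in> nbhd N q"
        for w' q'
      proof -
        have "q' \<in> cylinder (\<rho> n)" using \<open>selected j q n\<close> sel[OF that(3)] by (metis selected_def)
        then show ?thesis
          using that active_reduction(3)[OF act that(1)] act by (simp add: forward_simps the_restrict_problem)
      qed
      have "(w, q) \<in> ?E" using q x by (intro E) simp_all
      then obtain k where k: "\<And>w' q'. (w', q') \<in> ?E \<Longrightarrow> w' \<in> nbhd k w \<Longrightarrow> q' \<in> nbhd k q \<Longrightarrow>
          g j n (w', q') \<in> nbhd K (g j n (w, q))"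
        using active_reduction(2)[OF act] unfolding continuous_on_baire_pair_iff by meson
      have "backward (hashes_num j n \<frown> w', q') \<in> nbhd K (backward (hashes_num j n \<frown> w, q))"
        if w': "w' \<in> dom (ACC L (L \<alpha> j))" "w' \<in> nbhd (max N k) w"
          and q': "q' \<in> the (P (forward (hashes_num j n \<frown> w')))" "q' \<in> nbhd (max N k) q" for w' q'
      proof -
        have near: "w' \<in> nbhd k w" "q' \<in> nbhd k q" "q' \<in> nbhd N q"
          using w'(2) q'(2) nbhd_antimono[of k "max N k"] nbhd_antimono[of N "max N k"] by auto
        then have "g j n (w', q') \<in> nbhd K (g j n (w, q))" using E w'(1) q'(1) by (intro k)
        then have "num_hashes n j \<frown> g j n (w', q') \<in> nbhd K (num_hashes n j \<frown> g j n (w, q))"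
          using conc_in_nbhd[of "g j n (w', q')" "g j n (w, q)" K "num_hashes n j"]
            nbhd_antimono[of K "length (num_hashes n j) + K"] by (meson le_add2 subsetD)
        moreover have "(LEAST m. selected j q' m) = n" "\<exists>m. selected j q' m"
          unfolding sel[OF near(3)] using ex least by simp_all
        ultimately show ?thesis using ex least by (simp only: backward_simps if_True simp_thms)
      qed
      then show ?thesis by (meson max.cobounded1)
    next
      case False
      have "backward (hashes_num j n \<frown> w', q') \<in> nbhd K (backward (hashes_num j n \<frown> w, q))"
        if "q' \<in> nbhd N q" for w' q'
        unfolding backward_simps sel[OF that] using False by auto
      then show ?thesis by blast
    qed
    then obtain k where k: "\<And>w' q'. w' \<in> dom (ACC L (L \<alpha> j)) \<Longrightarrow>
        q' \<in> the (P (forward (hashes_num j n \<frown> w'))) \<Longrightarrow> w' \<in> nbhd k w \<Longrightarrow> q' \<in> nbhd k q \<Longrightarrow>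
        backward (hashes_num j n \<frown> w', q') \<in> nbhd K (backward (hashes_num j n \<frown> w, q))" by blast
    have "backward (x', q') \<in> nbhd K (backward (x, q))"
      if x': "(x', q') \<in> ?D" "x' \<in> nbhd (Suc j + k) x" and q': "q' \<in> nbhd (Suc j + k) q" for x' q'
    proof -
      obtain w' where w': "x' = hashes_num j n \<frown> w'" "w' \<in> nbhd k w"
        using x'(2) unfolding x(1) by (rule nbhd_hashes_num)
      have "w' \<in> dom (ACC L (L \<alpha> j))" "q' \<in> the (P (forward (hashes_num j n \<frown> w')))"
        using x'(1) hashes_num_in_dom_ACC[OF pos] unfolding w'(1) by simp_all
      moreover have "q' \<in> nbhd k q" using q' nbhd_antimono[of k "Suc j + k" q] by auto
      ultimately show ?thesis unfolding x(1) w'(1) using w'(2) by (intro k)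
    qed
    then show ?thesis by blast
  qed
qed

lemma ACC_reduction: "weihrauch_total (ACC L \<alpha>) P forward backward"
  unfolding weihrauch_total_def
  using continuous_on_forward continuous_on_backward forward_in_dom backward_solves by blast

end

lemma weihrauch_total_no_solutions:
  assumes "p \<in> dom Q" "the (Q p) = {}"
  shows "weihrauch_total P Q (\<lambda>_. p) \<psi>"
  unfolding weihrauch_total_def using assms by simp

text \<open>
  All finite strings are enumerated by \<open>\<rho>\<close>.  If the \<open>n\<close>-th one can be imposed by Player 1, then every
  neighbourhood of \<open>p\<close> contains an answering instance of rank at most \<open>L \<alpha> j\<close> for \<open>j\<close> large, and \<open>d j n\<close>
  is the largest depth up to \<open>j\<close> at which this happens.  For each fixed \<open>n\<close> it tends to infinity.  It does so uniformly
  because \<open>n\<close> becomes active only when depth \<open>n\<close> has been reached: numbers \<open>n \<ge> K\<close> then have depth at least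
  \<open>K\<close>, and only finitely many other numbers remain.
\<close>

lemma wins_imp_ACC_reduction:
  "rank_witnessing_representation \<alpha> L \<Longrightarrow> wins \<alpha> P p \<Longrightarrow>
    \<exists>\<phi> \<psi>. weihrauch_total (ACC L \<alpha>) P \<phi> \<psi> \<and> \<phi> hash_omega = p"
proof (induction \<alpha> arbitrary: P p rule: less_induct)
  case (less \<alpha>)
  have p: "p \<in> dom P" using less.prems(2) by (rule wins_dom)
  show ?case
  proof (cases "the (P p) = {}")
    case True
    then show ?thesis using weihrauch_total_no_solutions[OF p] by blast
  next
    case False
    then obtain q\<^sub>0 where "q\<^sub>0 \<in> the (P p)" by blast
    then have "\<exists>\<gamma>. \<gamma> < \<alpha>" using wins_reply[OF less.prems(2)] by blast
    then have pos: "0 < \<alpha>" using le_less_trans zero_le_omega1 by blast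
    note L = rank_witnessing_representationD[OF less.prems(1) pos]
    define \<rho> where "\<rho> n = (from_nat n :: nat list)" for n
    define win where
      "win j n k \<longleftrightarrow> (\<exists>p'. wins (L \<alpha> j) (restrict_problem P (nbhd k p) (cylinder (\<rho> n))) p')" for j n k
    define reply where "reply n \<longleftrightarrow> (\<forall>k. \<exists>j. win j n k)" for n
    \<comment> \<open>Depth \<open>n\<close> is required of the \<open>n\<close>-th string; this makes the convergence uniform in \<open>n\<close>.\<close>
    define active where "active j n \<longleftrightarrow> reply n \<and> n \<le> j \<and> win j n n" for j n
    have win_mono: "win j' n k" if "win j n k" "j \<le> j'" for j j' n k
      using that wins_mono L(2) unfolding win_def by blast
    have covered: "\<exists>n j. active j n \<and> q \<in> cylinder (\<rho> n)" if q: "q \<in> the (P p)" for q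
    proof -
      obtain l where l: "\<forall>k. \<exists>\<gamma><\<alpha>. \<exists>p'. wins \<gamma> (restrict_problem P (nbhd k p) (nbhd l q)) p'"
        using wins_reply[OF less.prems(2), OF q] ..
      define n where "n = to_nat (prefix l q)"
      have n: "\<rho> n = prefix l q" by (simp add: \<rho>_def n_def)
      have "\<exists>j. win j n k" for k
      proof -
        obtain \<gamma> p' where \<gamma>: "\<gamma> < \<alpha>" "wins \<gamma> (restrict_problem P (nbhd k p) (nbhd l q)) p'"
          using l by blast
        obtain j where "\<gamma> \<le> L \<alpha> j" using L(3)[OF \<gamma>(1)] ..
        then show ?thesis unfolding win_def n using wins_mono[OF \<gamma>(2)] by blast
      qed
      then have "reply n" unfolding reply_def by blast
      moreover then obtain j where "win j n n" unfolding reply_def by blast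
      then have "win (max j n) n n" by (rule win_mono) simp
      ultimately have "active (max j n) n" unfolding active_def by simp
      then show ?thesis using n by auto
    qed
    define d where "d j n = (GREATEST k. win j n k \<and> k \<le> j)" for j n
    have d: "win j n (d j n)" and d_ge: "\<And>k. win j n k \<Longrightarrow> k \<le> j \<Longrightarrow> k \<le> d j n"
      if "active j n" for j n
    proof -
      have n: "win j n n \<and> n \<le> j" using that by (simp add: active_def)
      show "win j n (d j n)"
        using GreatestI_nat[of "\<lambda>k. win j n k \<and> k \<le> j", OF n] unfolding d_def by blast
      show "k \<le> d j n" if "win j n k" "k \<le> j" for k
        unfolding d_def by (rule Greatest_le_nat) (use that in auto)
    qed
    have depth: "\<exists>J. \<forall>j\<ge>J. \<forall>n. active j n \<longrightarrow> K \<le> d j n" for K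
    proof -
      have "\<exists>J. reply n \<longrightarrow> win J n K" for n unfolding reply_def by blast
      then obtain J where J: "\<And>n. reply n \<Longrightarrow> win (J n) n K" by metis
      \<comment> \<open>The sum serves as a common bound of all \<open>J n\<close> with \<open>n < K\<close>.\<close>
      have "K \<le> d j n" if j: "K + (\<Sum>n<K. J n) \<le> j" and act: "active j n" for j n
      proof (cases "n < K")
        case True
        have "J n \<le> (\<Sum>n<K. J n)" by (rule member_le_sum) (use True in auto)
        then have "win j n K" using J[of n] win_mono[of "J n" n K j] j act by (simp add: active_def)
        then show ?thesis using d_ge[OF act, of K] j by simp
      next
        case False
        have "win j n n" "n \<le> j" using act by (simp_all add: active_def)
        then show ?thesis using d_ge[OF act, of n] False by simp
      qed
      then show ?thesis by blast
    qed
    let ?piece = "\<lambda>j n. restrict_problem P (nbhd (d j n) p) (cylinder (\<rho> n))"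
    have "\<exists>\<phi>\<psi>. active j n \<longrightarrow> weihrauch_total (ACC L (L \<alpha> j)) (?piece j n) (fst \<phi>\<psi>) (snd \<phi>\<psi>)" for j n
    proof (cases "active j n")
      case True
      obtain p' where p': "wins (L \<alpha> j) (?piece j n) p'" using d[OF True] unfolding win_def ..
      have "rank_witnessing_representation (L \<alpha> j) L"
        using less.prems(1) less_imp_le[OF L(1)] by (rule rank_witnessing_representation_le)
      then show ?thesis using less.IH[OF L(1) _ p'] by auto
    qed simp
    then obtain \<Phi> where \<Phi>: "\<And>j n. active j n \<Longrightarrow>
        weihrauch_total (ACC L (L \<alpha> j)) (?piece j n) (fst (\<Phi> j n)) (snd (\<Phi> j n))"
      by metis
    interpret ACC_gluing L \<alpha> P p active d \<rho> "\<lambda>j n. fst (\<Phi> j n)" "\<lambda>j n. snd (\<Phi> j n)"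
    proof
      show "active j n \<Longrightarrow> n \<le> j" for j n by (simp add: active_def)
      show "active j n \<Longrightarrow> j \<le> j' \<Longrightarrow> active j' n" for j j' n
        using win_mono by (auto simp: active_def)
    qed (use pos p covered depth \<Phi> in simp_all)
    show ?thesis using ACC_reduction forward_simps(1) by blast
  qed
qed


section \<open>Gluing local solutions\<close>

text \<open>
  Cylinders are either disjoint or nested, so continuous local solutions can be combined: each point \<open>x\<close> uses the
  solution attached to the largest cylinder around \<open>x\<close> that has one.  All points of that cylinder make the
  same choice.
\<close>

lemma glue_local_solutions:
  fixes D :: "baire set" and S :: "baire \<Rightarrow> baire set"
  assumes local: "\<And>x. x \<in> D \<Longrightarrow> \<exists>k f. continuous_on (D \<inter> nbhd k x) f \<and> (\<forall>y\<in>D \<inter> nbhd k x. f y \<in> S y)"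
  shows "\<exists>F. continuous_on D F \<and> (\<forall>y\<in>D. F y \<in> S y)"
proof -
  define sol where "sol \<sigma> f \<longleftrightarrow>
    continuous_on (D \<inter> cylinder \<sigma>) f \<and> (\<forall>y\<in>D \<inter> cylinder \<sigma>. f y \<in> S y)" for \<sigma> and f :: "baire \<Rightarrow> baire"
  define h where "h \<sigma> = (SOME f. sol \<sigma> f)" for \<sigma>
  define n where "n x = (LEAST k. \<exists>f. sol (prefix k x) f)" for x
  define F where "F x = h (prefix (n x) x) x" for x
  have ex: "\<exists>k. \<exists>f. sol (prefix k x) f" if "x \<in> D" for x
    using local[OF that] unfolding sol_def by blast
  have sol: "sol (prefix (n x) x) (h (prefix (n x) x))" if "x \<in> D" for x
  proof -
    have "\<exists>f. sol (prefix (n x) x) f" unfolding n_def using ex[OF that] by (rule LeastI_ex)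
    then show ?thesis unfolding h_def by (rule someI_ex)
  qed
  have F_eq: "F y = h (prefix (n x) x) y" if x: "x \<in> D" and y: "y \<in> nbhd (n x) x" for x y
  proof -
    have pre: "prefix k y = prefix k x" if "k \<le> n x" for k
      using nbhd_antimono[OF that, of x] y by (intro prefix_eq) blast
    have "n y = n x"
      unfolding n_def[of y]
    proof (rule Least_equality)
      show "\<exists>f. sol (prefix (n x) y) f" using sol[OF x] pre[OF order_refl] by auto
      fix k assume k: "\<exists>f. sol (prefix k y) f"
      show "n x \<le> k"
      proof (rule ccontr)
        assume "\<not> n x \<le> k"
        then have "k < n x" by simp
        then have "\<not> (\<exists>f. sol (prefix k x) f)" unfolding n_def by (rule not_less_Least)
        then show False using k pre[of k] \<open>k < n x\<close> by auto
      qed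
    qed
    then show ?thesis unfolding F_def using pre[OF order_refl] by simp
  qed
  have "continuous_on D F"
    unfolding continuous_on_baire_iff
  proof (intro ballI allI)
    fix x m assume x: "x \<in> D"
    have "continuous_on (D \<inter> nbhd (n x) x) (h (prefix (n x) x))" using sol[OF x] by (simp add: sol_def)
    moreover have "x \<in> D \<inter> nbhd (n x) x" using x by simp
    ultimately obtain k where k: "\<forall>y\<in>(D \<inter> nbhd (n x) x) \<inter> nbhd k x.
        h (prefix (n x) x) y \<in> nbhd m (h (prefix (n x) x) x)"
      unfolding continuous_on_baire_iff by blast
    have "F y \<in> nbhd m (F x)" if y: "y \<in> D \<inter> nbhd (max (n x) k) x" for y
    proof -
      have "y \<in> nbhd (n x) x" "y \<in> nbhd k x"
        using y nbhd_antimono[of "n x" "max (n x) k" x] nbhd_antimono[of k "max (n x) k" x] by auto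
      moreover then have "h (prefix (n x) x) y \<in> nbhd m (h (prefix (n x) x) x)" using k y by blast
      ultimately show ?thesis using F_eq[OF x] F_eq[OF x mem_nbhd_self] by (simp only:)
    qed
    then show "\<exists>k. \<forall>y\<in>D \<inter> nbhd k x. F y \<in> nbhd m (F x)" by blast
  qed
  moreover have "F y \<in> S y" if "y \<in> D" for y
    using sol[OF that] that unfolding F_def sol_def by simp
  ultimately show ?thesis by blast
qed

text \<open>
  If the claim fails, then for each \<open>l\<close> there is a neighbourhood of \<open>p\<close> such that, with solutions restricted
  to the first \<open>l\<close> letters of \<open>q\<close>, it contains no point of discontinuity other than \<open>p\<close>.  A
  point \<open>y \<noteq> p\<close> lies in only finitely many of these neighbourhoods once they are made to shrink to \<open>p\<close>; around
  \<open>y\<close> a local solution for the last of them respects all the others.  Glued together, these solutions converge to \<open>q\<close>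
  at \<open>p\<close>, so that \<open>p\<close> is not a point of discontinuity.
\<close>

lemma discontinuity_nearby:
  assumes disc: "discontinuity Q p" and q: "q \<in> the (Q p)"
  shows "\<exists>l. \<forall>k. \<exists>p'. p' \<noteq> p \<and> discontinuity (restrict_problem Q (nbhd k p) (nbhd l q)) p'"
proof (rule ccontr)
  assume "\<not> ?thesis"
  then have "\<exists>k. \<forall>p'. p' \<noteq> p \<longrightarrow> \<not> discontinuity (restrict_problem Q (nbhd k p) (nbhd l q)) p'" for l
    by meson
  then obtain \<kappa> where \<kappa>:
    "\<And>l p'. p' \<noteq> p \<Longrightarrow> \<not> discontinuity (restrict_problem Q (nbhd (\<kappa> l) p) (nbhd l q)) p'"
    by metis
  \<comment> \<open>Taking at least \<open>l\<close> letters makes the neighbourhoods shrink to \<open>p\<close>.\<close>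
  define \<mu> where "\<mu> l = max l (\<kappa> l)" for l
  have \<mu>: "\<not> discontinuity (restrict_problem Q (nbhd (\<mu> l) p) (nbhd l q)) y" if "y \<noteq> p" for l y
  proof
    assume d: "discontinuity (restrict_problem Q (nbhd (\<mu> l) p) (nbhd l q)) y"
    have "nbhd (\<mu> l) p \<subseteq> nbhd (\<kappa> l) p" by (rule nbhd_antimono) (simp add: \<mu>_def)
    then have "harder (restrict_problem Q (nbhd (\<kappa> l) p) (nbhd l q)) (restrict_problem Q (nbhd (\<mu> l) p) (nbhd l q))"
      by (intro harder_restrict_problem harder_refl) auto
    then show False using discontinuity_harder[OF _ d] \<kappa>[OF that] by blast
  qed
  define D where "D = dom Q \<inter> nbhd (\<mu> 0) p"
  define S where "S y = {z \<in> the (Q y). \<forall>l. y \<in> nbhd (\<mu> l) p \<longrightarrow> z \<in> nbhd l q}" for y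
  have "\<exists>k f. continuous_on ((D - {p}) \<inter> nbhd k y) f \<and> (\<forall>z\<in>(D - {p}) \<inter> nbhd k y. f z \<in> S z)"
    if y: "y \<in> D - {p}" for y
  proof -
    obtain i where i: "y i \<noteq> p i" using y by blast
    define m where "m = (GREATEST l. y \<in> nbhd (\<mu> l) p)"
    have bound: "l \<le> i" if "y \<in> nbhd (\<mu> l) p" for l
      using that i unfolding mem_nbhd \<mu>_def by (metis le_cases max.coboundedI1 order.strict_iff_order)
    have m: "y \<in> nbhd (\<mu> m) p"
      unfolding m_def by (rule GreatestI_nat[of _ 0 i]) (use y bound in \<open>auto simp: D_def\<close>)
    have m_ge: "l \<le> m" if "y \<in> nbhd (\<mu> l) p" for l
      unfolding m_def using that bound by (rule Greatest_le_nat)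
    let ?R = "restrict_problem Q (nbhd (\<mu> m) p) (nbhd m q)"
    have "y \<in> dom ?R" "\<not> discontinuity ?R y" using y m \<mu> by (simp_all add: D_def)
    then obtain k where "continuous_problem (restrict_problem ?R (nbhd k y) UNIV)"
      unfolding discontinuity_iff by blast
    then obtain f where f: "continuous_on (dom ?R \<inter> nbhd k y) f"
      "\<forall>z\<in>dom ?R \<inter> nbhd k y. f z \<in> the (restrict_problem ?R (nbhd k y) UNIV z)"
      unfolding continuous_problem_iff dom_restrict_problem[of ?R] by blast
    \<comment> \<open>The position \<open>i\<close> separates \<open>y\<close> from \<open>p\<close>: points that agree with \<open>y\<close> beyond \<open>i\<close> lie in no
      neighbourhood of \<open>p\<close> that does not already contain \<open>y\<close>.\<close>
    define k' where "k' = max k (max (Suc i) (\<mu> m))"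
    have near: "z \<in> dom ?R \<inter> nbhd k y" if z: "z \<in> (D - {p}) \<inter> nbhd k' y" for z
    proof -
      have "nbhd k' y \<subseteq> nbhd (\<mu> m) y" "nbhd k' y \<subseteq> nbhd k y"
        by (rule nbhd_antimono, simp add: k'_def)+
      then have "z \<in> nbhd (\<mu> m) y" "z \<in> nbhd k y" using z by blast+
      then show ?thesis using z nbhd_eq[OF m] by (simp add: D_def)
    qed
    have "f z \<in> S z" if z: "z \<in> (D - {p}) \<inter> nbhd k' y" for z
    proof -
      have "f z \<in> the (restrict_problem ?R (nbhd k y) UNIV z)" using near[OF z] f(2) by blast
      then have fz: "f z \<in> the (Q z)" "f z \<in> nbhd m q"
        using near[OF z] by (simp_all add: restrict_problem_restrict_problem the_restrict_problem)
      have "f z \<in> nbhd l q" if l: "z \<in> nbhd (\<mu> l) p" for l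
      proof -
        have zy: "z j = y j" if "j < k'" for j using z that by (simp add: mem_nbhd)
        have "z i \<noteq> p i" using zy[of i] i by (simp add: k'_def)
        then have "\<mu> l \<le> i" using l unfolding mem_nbhd by (meson not_le)
        then have "y \<in> nbhd (\<mu> l) p" using l zy unfolding mem_nbhd by (simp add: k'_def)
        then show ?thesis using fz(2) nbhd_antimono[OF m_ge] by blast
      qed
      then show ?thesis using fz(1) by (simp add: S_def)
    qed
    moreover have "continuous_on ((D - {p}) \<inter> nbhd k' y) f"
      using f(1) by (rule continuous_on_subset) (use near in blast)
    ultimately show ?thesis by blast
  qed
  then obtain F where F: "continuous_on (D - {p}) F" "\<forall>y\<in>D - {p}. F y \<in> S y"
    using glue_local_solutions[of "D - {p}" S] by blast
  define G where "G = F(p := q)"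
  have "continuous_on D G"
    unfolding continuous_on_baire_iff
  proof (intro ballI allI)
    fix y n assume y: "y \<in> D"
    show "\<exists>k. \<forall>z\<in>D \<inter> nbhd k y. G z \<in> nbhd n (G y)"
    proof (cases "y = p")
      case True
      have "G z \<in> nbhd n (G p)" if z: "z \<in> D \<inter> nbhd (\<mu> n) p" for z
      proof (cases "z = p")
        case False
        then have "F z \<in> S z" using F(2) z by blast
        then show ?thesis using z False by (simp add: S_def G_def)
      qed simp
      then show ?thesis unfolding True by blast
    next
      case False
      then obtain i where i: "y i \<noteq> p i" by blast
      obtain k where k: "\<forall>z\<in>(D - {p}) \<inter> nbhd k y. F z \<in> nbhd n (F y)"
        using F(1) y False unfolding continuous_on_baire_iff by blast
      have "G z \<in> nbhd n (G y)" if z: "z \<in> D \<inter> nbhd (max k (Suc i)) y" for z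
      proof -
        have "z \<in> nbhd k y" "z i = y i" using z by (auto simp: mem_nbhd)
        then show ?thesis using k z i False by (auto simp: G_def)
      qed
      then show ?thesis by blast
    qed
  qed
  moreover have "G y \<in> the (Q y)" if "y \<in> D" for y
    using F(2) that q by (cases "y = p") (auto simp: G_def S_def)
  ultimately have "continuous_problem (restrict_problem Q (nbhd (\<mu> 0) p) UNIV)"
    unfolding continuous_problem_iff D_def dom_restrict_problem
    by (intro exI[of _ G]) (simp add: the_restrict_problem)
  then show False using disc unfolding discontinuity_iff by blast
qed


section \<open>Cantor--Bendixson rank\<close>

lemma cb_iterate_mem_iff: "p \<in> cb_iterate A \<alpha> \<longleftrightarrow> p \<in> A \<and> (\<forall>\<beta><\<alpha>. p \<in> cb_iterate A (osuc \<beta>))"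
  by (subst cb_iterate.simps) (auto simp: cb_iterate_osuc)

lemma osuc_le_iff: "osuc \<alpha> \<le> \<beta> \<longleftrightarrow> \<alpha> < \<beta>"
  using less_osuc_iff[of \<beta> \<alpha>] by (metis linorder_not_less)

lemma last_cb_iterate:
  assumes "p \<in> A" "p \<notin> cb_iterate A (osuc \<alpha>)"
  shows "\<exists>\<beta>\<le>\<alpha>. p \<in> cb_iterate A \<beta> - cb_iterate A (osuc \<beta>)"
proof -
  define \<beta> where "\<beta> = (LEAST \<beta>. p \<notin> cb_iterate A (osuc \<beta>))"
  have "p \<notin> cb_iterate A (osuc \<beta>)" unfolding \<beta>_def using assms(2) by (rule LeastI)
  moreover have "\<beta> \<le> \<alpha>" unfolding \<beta>_def using assms(2) by (rule Least_le)
  moreover have "p \<in> cb_iterate A (osuc \<gamma>)" if "\<gamma> < \<beta>" for \<gamma>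
    using not_less_Least[OF that[unfolded \<beta>_def]] by blast
  then have "p \<in> cb_iterate A \<beta>" using assms(1) cb_iterate_mem_iff by blast
  ultimately show ?thesis by blast
qed

lemma cb_rank_le_iff:
  assumes "p \<in> A"
  shows "cb_rank A p \<le> Fin \<alpha> \<longleftrightarrow> p \<notin> cb_iterate A (osuc \<alpha>)"
proof -
  have rank: "cb_rank A p = Fin \<beta>" if \<beta>: "p \<in> cb_iterate A \<beta> - cb_iterate A (osuc \<beta>)" for \<beta>
  proof -
    have "\<gamma> = \<beta>" if "p \<in> cb_iterate A \<gamma> - cb_iterate A (osuc \<gamma>)" for \<gamma>
      using that \<beta> cb_iterate_antimono[of "osuc \<beta>" \<gamma> A] cb_iterate_antimono[of "osuc \<gamma>" \<beta> A]
      unfolding osuc_le_iff by (cases \<beta> \<gamma> rule: linorder_cases) auto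
    then have "(THE \<beta>. p \<in> cb_iterate A \<beta> - cb_iterate A (osuc \<beta>)) = \<beta>"
      using \<beta> by (intro the_equality)
    then show ?thesis unfolding cb_rank_def using \<beta> by auto
  qed
  show ?thesis
  proof
    assume le: "cb_rank A p \<le> Fin \<alpha>"
    then obtain \<beta> where \<beta>: "p \<in> cb_iterate A \<beta> - cb_iterate A (osuc \<beta>)"
      unfolding cb_rank_def by (auto split: if_splits)
    then have "\<beta> \<le> \<alpha>" using le rank by simp
    then have "osuc \<beta> \<le> osuc \<alpha>" by (simp add: osuc_le_iff less_osuc_iff)
    then show "p \<notin> cb_iterate A (osuc \<alpha>)" using \<beta> cb_iterate_antimono by blast
  next
    assume "p \<notin> cb_iterate A (osuc \<alpha>)"
    then obtain \<beta> where "\<beta> \<le> \<alpha>" "p \<in> cb_iterate A \<beta> - cb_iterate A (osuc \<beta>)"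
      using last_cb_iterate[OF assms] by blast
    then show "cb_rank A p \<le> Fin \<alpha>" using rank by simp
  qed
qed

text \<open>
  A point of rank at most \<open>\<alpha>\<close> is isolated among the points of the same or larger rank.
\<close>

lemma cb_iterate_neighbours:
  assumes "p \<in> A" "p \<notin> cb_iterate A (osuc \<alpha>)"
  shows "\<exists>k. \<forall>x\<in>A \<inter> nbhd k p. x \<noteq> p \<longrightarrow> (\<exists>\<gamma><\<alpha>. x \<notin> cb_iterate A (osuc \<gamma>))"
proof -
  obtain \<beta> where \<beta>: "\<beta> \<le> \<alpha>" "p \<in> cb_iterate A \<beta>" "p \<notin> cb_iterate A (osuc \<beta>)"
    using last_cb_iterate[OF assms] by blast
  then have "\<not> p islimpt cb_iterate A \<beta>" by (simp add: cb_iterate_osuc cb_derivative_def)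
  then obtain U where U: "open U" "p \<in> U" "\<And>x. x \<in> U \<Longrightarrow> x \<noteq> p \<Longrightarrow> x \<notin> cb_iterate A \<beta>"
    unfolding islimpt_def by blast
  obtain k where "nbhd k p \<subseteq> U" using open_contains_nbhd[OF U(1,2)] by blast
  then have "\<exists>\<gamma><\<alpha>. x \<notin> cb_iterate A (osuc \<gamma>)" if "x \<in> A \<inter> nbhd k p" "x \<noteq> p" for x
    using U(3)[of x] that \<beta>(1) cb_iterate_mem_iff[of x A \<beta>] less_le_trans by blast
  then show ?thesis by blast
qed

lemma cb_iterate_mono: "A \<subseteq> B \<Longrightarrow> cb_iterate A \<alpha> \<subseteq> cb_iterate B \<alpha>"
proof (induction \<alpha> rule: less_induct)
  case (less \<alpha>)
  then have "cb_derivative (cb_iterate A \<beta>) \<subseteq> cb_derivative (cb_iterate B \<beta>)" if "\<beta> < \<alpha>" for \<beta>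
    using that unfolding cb_derivative_def by (blast intro: islimpt_subset)
  then show ?case using less.prems by (subst (1 2) cb_iterate.simps) blast
qed

lemma cb_iterate_local: "open U \<Longrightarrow> cb_iterate A \<alpha> \<inter> U \<subseteq> cb_iterate (A \<inter> U) \<alpha>"
proof (induction \<alpha> rule: less_induct)
  case (less \<alpha>)
  have "x \<in> cb_derivative (cb_iterate (A \<inter> U) \<beta>)"
    if \<beta>: "\<beta> < \<alpha>" and x: "x \<in> cb_derivative (cb_iterate A \<beta>)" "x \<in> U" for x \<beta>
  proof -
    have sub: "cb_iterate A \<beta> \<inter> U \<subseteq> cb_iterate (A \<inter> U) \<beta>" using less \<beta> by blast
    have lim: "x \<in> cb_iterate A \<beta>" "x islimpt cb_iterate A \<beta>" using x(1) by (simp_all add: cb_derivative_def)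
    have "x islimpt cb_iterate A \<beta> \<inter> U"
      unfolding islimpt_def
    proof (intro allI impI)
      fix T assume "x \<in> T" "open T"
      then have "x \<in> T \<inter> U" "open (T \<inter> U)" using x(2) less.prems by auto
      then show "\<exists>y\<in>cb_iterate A \<beta> \<inter> U. y \<in> T \<and> y \<noteq> x"
        using lim(2) unfolding islimpt_def by (metis IntD1 IntD2 IntI)
    qed
    then show ?thesis using lim(1) x(2) sub islimpt_subset unfolding cb_derivative_def by blast
  qed
  then show ?case by (subst (1 2) cb_iterate.simps) blast
qed


section \<open>From sets of small rank to wins\<close>

text \<open>
  Player 1 plays points of discontinuity of \<open>P\<close> on \<open>A\<close> only.  By \<open>discontinuity_nearby\<close> she finds
  them arbitrarily close to the previous one and different from it, and close enough they have smaller
  rank in \<open>A\<close>.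
\<close>

lemma discontinuity_on_set_imp_wins:
  "discontinuity (restrict_problem P A UNIV) p \<Longrightarrow> p \<notin> cb_iterate A (osuc \<alpha>) \<Longrightarrow> wins \<alpha> P p"
proof (induction \<alpha> arbitrary: P p rule: less_induct)
  case (less \<alpha>)
  have p: "p \<in> dom P \<inter> A" using less.prems(1) unfolding discontinuity_def by simp
  then obtain k\<^sub>0 where k\<^sub>0: "\<forall>x\<in>A \<inter> nbhd k\<^sub>0 p. x \<noteq> p \<longrightarrow> (\<exists>\<gamma><\<alpha>. x \<notin> cb_iterate A (osuc \<gamma>))"
    using cb_iterate_neighbours less.prems(2) by blast
  show ?case
  proof (rule wins.intros)
    show "p \<in> dom P" using p by blast
    fix q assume "q \<in> the (P p)"
    then have "q \<in> the (restrict_problem P A UNIV p)" using p by (simp add: the_restrict_problem)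
    from discontinuity_nearby[OF less.prems(1), OF this] obtain l where
      l: "\<forall>k. \<exists>p'. p' \<noteq> p \<and>
        discontinuity (restrict_problem (restrict_problem P A UNIV) (nbhd k p) (nbhd l q)) p'" ..
    have "\<exists>\<gamma><\<alpha>. \<exists>p'. wins \<gamma> (restrict_problem P (nbhd k p) (nbhd l q)) p'" for k
    proof -
      let ?Q = "restrict_problem P (nbhd k p) (nbhd l q)"
      \<comment> \<open>Inside the first \<open>k\<^sub>0\<close> letters of \<open>p\<close> all other points of \<open>A\<close> have smaller rank.\<close>
      let ?R = "restrict_problem (restrict_problem P A UNIV) (nbhd (max k k\<^sub>0) p) (nbhd l q)"
      obtain p' where p': "p' \<noteq> p" "discontinuity ?R p'" using l by blast
      have sub: "nbhd (max k k\<^sub>0) p \<subseteq> nbhd k p" "nbhd (max k k\<^sub>0) p \<subseteq> nbhd k\<^sub>0 p"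
        by (simp_all add: nbhd_antimono)
      have "p' \<in> dom ?R" using p'(2) unfolding discontinuity_def by blast
      then have "p' \<in> A \<inter> nbhd k\<^sub>0 p" using sub(2) unfolding dom_restrict_problem by blast
      then obtain \<gamma> where \<gamma>: "\<gamma> < \<alpha>" "p' \<notin> cb_iterate A (osuc \<gamma>)" using k\<^sub>0 p'(1) by blast
      have "harder (restrict_problem ?Q A UNIV) ?R"
        unfolding restrict_problem_restrict_problem
        by (intro harder_restrict_problem harder_refl) (use sub(1) in auto)
      then have "discontinuity (restrict_problem ?Q A UNIV) p'"
        using p'(2) by (rule discontinuity_harder)
      then have "wins \<gamma> ?Q p'" using \<gamma> by (intro less.IH)
      then show ?thesis using \<gamma>(1) by blast
    qed
    then show "\<exists>l. \<forall>k. \<exists>\<gamma><\<alpha>. \<exists>p'. wins \<gamma> (restrict_problem P (nbhd k p) (nbhd l q)) p'" by blast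
  qed
qed


section \<open>From wins to sets of small rank\<close>

lemma discontinuity_restrict_nbhd:
  assumes "discontinuity (restrict_problem P A UNIV) p"
  shows "discontinuity (restrict_problem P (A \<inter> nbhd k p) UNIV) p"
  unfolding discontinuity_iff
proof (intro conjI allI notI)
  show "p \<in> dom (restrict_problem P (A \<inter> nbhd k p) UNIV)"
    using assms unfolding discontinuity_def by simp
  fix m
  assume "continuous_problem (restrict_problem (restrict_problem P (A \<inter> nbhd k p) UNIV) (nbhd m p) UNIV)"
  moreover have "nbhd (max k m) p \<subseteq> nbhd k p \<inter> nbhd m p" by (simp add: nbhd_antimono)
  ultimately have "continuous_problem (restrict_problem (restrict_problem P A UNIV) (nbhd (max k m) p) UNIV)"
    unfolding restrict_problem_restrict_problem
    by (elim continuous_problem_harder[rotated], intro harder_restrict_problem harder_refl) auto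
  then show False using assms unfolding discontinuity_iff by blast
qed

lemma cb_iterate_osuc_single:
  assumes "cb_iterate A \<alpha> \<subseteq> {p}"
  shows "cb_iterate A (osuc \<alpha>) = {}"
proof -
  have False if x: "x \<in> cb_iterate A \<alpha>" and lim: "x islimpt cb_iterate A \<alpha>" for x
  proof -
    obtain y where "y \<in> cb_iterate A \<alpha>" "y \<noteq> x"
      using lim[unfolded islimpt_def, rule_format, of UNIV] by auto
    then show False using x assms by blast
  qed
  then show ?thesis by (auto simp: cb_iterate_osuc cb_derivative_def)
qed

text \<open>
  Each \<open>B i\<close> is relatively open in the union, since the shells are disjoint and clopen; so the rank of its points is
  the same in the union, and \<open>p\<close> is the only point that can survive \<open>\<alpha>\<close> derivatives.
\<close>

lemma cb_iterate_shells:
  assumes K: "strict_mono K"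
    and B: "\<And>i. B i \<subseteq> nbhd (K i) p - nbhd (K (Suc i)) p" "\<And>i. cb_iterate (B i) \<alpha> = {}"
  shows "cb_iterate (insert p (\<Union>i. B i)) (osuc \<alpha>) = {}"
proof (rule cb_iterate_osuc_single, rule subsetI, rule ccontr)
  let ?A = "insert p (\<Union>i. B i)"
  fix x assume x: "x \<in> cb_iterate ?A \<alpha>" "x \<notin> {p}"
  then have "x \<in> ?A" using cb_iterate_mem_iff[of x ?A \<alpha>] by simp
  then obtain i where i: "x \<in> B i" using x(2) by blast
  let ?U = "nbhd (K (Suc i)) x"
  have "?A \<inter> ?U \<subseteq> B i"
  proof
    fix y assume y: "y \<in> ?A \<inter> ?U"
    have le: "K i \<le> K (Suc i)" using K by (simp add: strict_mono_leD)
    have shell: "y \<in> nbhd (K i) p" "y \<notin> nbhd (K (Suc i)) p"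
    proof -
      have "x \<in> nbhd (K i) p" "x \<notin> nbhd (K (Suc i)) p" using B(1) i by blast+
      then show "y \<in> nbhd (K i) p" "y \<notin> nbhd (K (Suc i)) p"
        using y le unfolding Int_iff mem_nbhd by auto
    qed
    have "y \<noteq> p" using shell(2) by auto
    then obtain j where j: "y \<in> B j" using y by blast
    then have yj: "y \<in> nbhd (K j) p" "y \<notin> nbhd (K (Suc j)) p" using B(1) by blast+
    have "\<not> j < i"
    proof
      assume "j < i"
      then have "K (Suc j) \<le> K i" using K by (simp add: strict_mono_leD)
      then show False using nbhd_antimono shell(1) yj(2) by blast
    qed
    moreover have "\<not> i < j"
    proof
      assume "i < j"
      then have "K (Suc i) \<le> K j" using K by (simp add: strict_mono_leD)
      then show False using nbhd_antimono shell(2) yj(1) by blast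
    qed
    ultimately show "y \<in> B i" using j by (metis linorder_neqE_nat)
  qed
  then have "cb_iterate ?A \<alpha> \<inter> ?U \<subseteq> cb_iterate (B i) \<alpha>"
    using cb_iterate_local[of ?U ?A \<alpha>] cb_iterate_mono[of "?A \<inter> ?U" "B i" \<alpha>] by auto
  then show False using B(2) x(1) by auto
qed

text \<open>
  The set consists of \<open>p\<close> and of sets of smaller rank, provided by the induction hypothesis, in consecutive
  shells around \<open>p\<close>.  A shell serves only one string \<open>\<rho>\<close>; if Player 1 can impose \<open>\<rho>\<close>, it contains
  a point of discontinuity of the problem restricted to \<open>\<rho>\<close>.  Every string gets infinitely
  many shells.  A continuous solution \<open>f\<close> near \<open>p\<close> would respect, close to \<open>p\<close>, the segment of \<open>f p\<close> that
  Player 1 imposes, and so would solve the restricted problem in some shell serving that segment.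
\<close>

lemma wins_imp_discontinuity_on_set:
  "wins \<alpha> P p \<Longrightarrow> \<exists>A. p \<in> A \<and> discontinuity (restrict_problem P A UNIV) p \<and> cb_iterate A (osuc \<alpha>) = {}"
proof (induction \<alpha> arbitrary: P p rule: less_induct)
  case (less \<alpha>)
  define reply where "reply \<rho> \<longleftrightarrow> (\<forall>k. \<exists>\<gamma><\<alpha>. \<exists>p'. p' \<noteq> p \<and>
      wins \<gamma> (restrict_problem P (nbhd k p) (cylinder \<rho>)) p')" for \<rho>
  define shell where "shell k \<rho> B d \<longleftrightarrow> k < d \<and> B \<subseteq> nbhd k p - nbhd d p \<and> cb_iterate B \<alpha> = {} \<and>
    (reply \<rho> \<longrightarrow> (\<exists>p'. discontinuity (restrict_problem P B (cylinder \<rho>)) p'))" for k \<rho> B d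
  have "\<exists>B d. shell k \<rho> B d" for k \<rho>
  proof (cases "reply \<rho>")
    case True
    then obtain \<gamma> p' where \<gamma>: "\<gamma> < \<alpha>" and p': "p' \<noteq> p"
      "wins \<gamma> (restrict_problem P (nbhd k p) (cylinder \<rho>)) p'" unfolding reply_def by blast
    obtain B where B: "p' \<in> B" "cb_iterate B (osuc \<gamma>) = {}"
      "discontinuity (restrict_problem (restrict_problem P (nbhd k p) (cylinder \<rho>)) B UNIV) p'"
      using less.IH[OF \<gamma> p'(2)] by blast
    obtain i where i: "p' i \<noteq> p i" using p'(1) by blast
    define m where "m = Suc (max k i)"
    have m: "k < m" "i < m" by (simp_all add: m_def)
    let ?B = "B \<inter> nbhd m p'"
    have "p' \<in> nbhd k p" using wins_dom[OF p'(2)] by simp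
    then have "?B \<subseteq> nbhd k p - nbhd m p"
      using i m by (auto simp: mem_nbhd)
    moreover have "cb_iterate ?B \<alpha> = {}"
      using cb_iterate_mono[of ?B B \<alpha>] cb_iterate_antimono[of "osuc \<gamma>" \<alpha> B] B(2) \<gamma>
      by (auto simp: osuc_le_iff)
    moreover have "discontinuity (restrict_problem P ?B (cylinder \<rho>)) p'"
    proof (rule discontinuity_harder)
      show "discontinuity (restrict_problem (restrict_problem P (nbhd k p) (cylinder \<rho>)) ?B UNIV) p'"
        using B(3) by (rule discontinuity_restrict_nbhd)
      show "harder (restrict_problem P ?B (cylinder \<rho>))
          (restrict_problem (restrict_problem P (nbhd k p) (cylinder \<rho>)) ?B UNIV)"
        unfolding restrict_problem_restrict_problem
        by (intro harder_restrict_problem harder_refl) auto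
    qed
    ultimately have "shell k \<rho> ?B m" unfolding shell_def using m(1) by blast
    then show ?thesis by blast
  next
    case False
    have "cb_iterate {} \<alpha> = {}" using cb_iterate_mem_iff by blast
    then have "shell k \<rho> {} (Suc k)" unfolding shell_def using False by simp
    then show ?thesis by blast
  qed
  then obtain B d where shell: "\<And>k \<rho>. shell k \<rho> (B k \<rho>) (d k \<rho>)" by metis
  \<comment> \<open>This sequence takes every string as value infinitely often.\<close>
  define \<rho> where "\<rho> i = (from_nat (fst (prod_decode i)) :: nat list)" for i
  \<comment> \<open>The next shell starts where the previous one ends.\<close>
  define K where "K = rec_nat 0 (\<lambda>i k. d k (\<rho> i))"
  define C where "C i = B (K i) (\<rho> i)" for i
  have K_Suc: "K (Suc i) = d (K i) (\<rho> i)" for i by (simp add: K_def)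
  have shell_C: "shell (K i) (\<rho> i) (C i) (K (Suc i))" for i unfolding C_def K_Suc by (rule shell)
  have K: "strict_mono K" using shell_C unfolding strict_mono_Suc_iff shell_def by blast
  define A where "A = insert p (\<Union>i. C i)"
  have "cb_iterate A (osuc \<alpha>) = {}"
    unfolding A_def by (rule cb_iterate_shells[OF K]) (use shell_C in \<open>auto simp: shell_def\<close>)
  moreover have "discontinuity (restrict_problem P A UNIV) p"
    unfolding discontinuity_iff
  proof (intro conjI allI notI)
    have p: "p \<in> dom P" using less.prems by (rule wins_dom)
    then show "p \<in> dom (restrict_problem P A UNIV)" by (simp add: A_def)
    fix k assume "continuous_problem (restrict_problem (restrict_problem P A UNIV) (nbhd k p) UNIV)"
    then obtain f where f: "continuous_on (dom P \<inter> A \<inter> nbhd k p) f"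
      "\<forall>x\<in>dom P \<inter> A \<inter> nbhd k p. f x \<in> the (restrict_problem (restrict_problem P A UNIV) (nbhd k p) UNIV x)"
      unfolding continuous_problem_iff dom_restrict_problem by blast
    have fP: "f x \<in> the (P x)" if "x \<in> dom P \<inter> A \<inter> nbhd k p" for x
      using bspec[OF f(2) that] that by (simp add: restrict_problem_restrict_problem the_restrict_problem)
    have pD: "p \<in> dom P \<inter> A \<inter> nbhd k p" using p by (simp add: A_def)
    define q where "q = f p"
    have "q \<in> the (P p)" unfolding q_def using pD by (rule fP)
    from wins_other_point[OF less.prems, OF this] obtain l where "reply (prefix l q)"
      unfolding reply_def by blast
    obtain m where m: "\<forall>x\<in>dom P \<inter> A \<inter> nbhd k p \<inter> nbhd m p. f x \<in> nbhd l q"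
      using f(1) pD unfolding continuous_on_baire_iff q_def by blast
    \<comment> \<open>An index that serves this segment and lies deep enough for the continuity of \<open>f\<close>.\<close>
    define i where "i = prod_encode (to_nat (prefix l q), max k m)"
    have \<rho>i: "\<rho> i = prefix l q" by (simp add: \<rho>_def i_def)
    have "max k m \<le> i" unfolding i_def by (rule le_prod_encode_2)
    then have "max k m \<le> K i" using strict_mono_imp_increasing[OF K, of i] by simp
    then have near: "nbhd (K i) p \<subseteq> nbhd k p" "nbhd (K i) p \<subseteq> nbhd m p"
      by (simp_all add: nbhd_antimono)
    let ?R = "restrict_problem P (C i) (nbhd l q)"
    obtain p' where "discontinuity ?R p'"
      using shell_C[of i] \<open>reply (prefix l q)\<close> unfolding shell_def \<rho>i by blast
    moreover have "continuous_problem ?R"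
    proof -
      have sub: "x \<in> dom P \<inter> A \<inter> nbhd k p \<inter> nbhd m p" if "x \<in> dom ?R" for x
        using that near shell_C[of i] unfolding shell_def A_def dom_restrict_problem by blast
      have "continuous_on (dom ?R) f"
        using f(1) by (rule continuous_on_subset) (use sub in blast)
      moreover have "f x \<in> the (?R x)" if "x \<in> dom ?R" for x
        using sub[OF that] m fP[of x] that by (simp add: the_restrict_problem)
      ultimately show ?thesis unfolding continuous_problem_iff by blast
    qed
    ultimately show False using discontinuity_imp_not_continuous by blast
  qed
  moreover have "p \<in> A" by (simp add: A_def)
  ultimately show ?case by blast
qed

lemma discontinuity_on_set_iff_wins:
  "(\<exists>A. \<not> continuous_problem (P |` A) \<and> discontinuity (P |` A) p \<and> cb_rank A p \<le> Fin \<alpha>) \<longleftrightarrow>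
    wins \<alpha> P p"
proof
  assume "\<exists>A. \<not> continuous_problem (P |` A) \<and> discontinuity (P |` A) p \<and> cb_rank A p \<le> Fin \<alpha>"
  then obtain A where A: "discontinuity (restrict_problem P A UNIV) p" "cb_rank A p \<le> Fin \<alpha>"
    unfolding restrict_map_eq_restrict_problem by blast
  have "p \<in> A" using A(1) unfolding discontinuity_def by simp
  then show "wins \<alpha> P p"
    using A cb_rank_le_iff discontinuity_on_set_imp_wins by blast
next
  assume "wins \<alpha> P p"
  then obtain A where A: "p \<in> A" "discontinuity (restrict_problem P A UNIV) p"
    "cb_iterate A (osuc \<alpha>) = {}" using wins_imp_discontinuity_on_set by blast
  then have "cb_rank A p \<le> Fin \<alpha>" using cb_rank_le_iff by blast
  then show "\<exists>A. \<not> continuous_problem (P |` A) \<and> discontinuity (P |` A) p \<and> cb_rank A p \<le> Fin \<alpha>"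
    unfolding restrict_map_eq_restrict_problem
    using A(2) discontinuity_imp_not_continuous by blast
qed

theorem theorem2:
  fixes P :: problem and p :: baire and \<alpha> :: omega1
    and L :: "omega1 \<Rightarrow> nat \<Rightarrow> omega1"
  assumes "p \<in> dom P"
    and "rank_witnessing_representation \<alpha> L"
  shows
    "((\<exists>A. \<not> continuous_problem (P |` A) \<and> discontinuity (P |` A) p \<and> cb_rank A p \<le> Fin \<alpha>)
        \<longleftrightarrow> (\<exists>\<Phi> \<Psi>. weihrauch_via (ACC L \<alpha>) P \<Phi> \<Psi> \<and> \<Phi> hash_omega = Some p)) \<and>
     ((\<exists>\<Phi> \<Psi>. weihrauch_via (ACC L \<alpha>) P \<Phi> \<Psi> \<and> \<Phi> hash_omega = Some p)
        \<longleftrightarrow> (\<exists>s. winning_strategy s (Start \<alpha> P) \<and> s [] = Point p)) \<and>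
     ((\<exists>s. winning_strategy s (Start \<alpha> P) \<and> s [] = Point p)
        \<longleftrightarrow> (\<exists>\<beta>\<le>\<alpha>. rank_discontinuity \<beta> P p))"
proof -
  have "(\<exists>\<Phi> \<Psi>. weihrauch_via (ACC L \<alpha>) P \<Phi> \<Psi> \<and> \<Phi> hash_omega = Some p) \<longleftrightarrow> wins \<alpha> P p"
    unfolding weihrauch_via_iff_total[OF hash_omega_in_dom_ACC]
    using ACC_reduction_imp_wins[OF assms(2)] wins_imp_ACC_reduction[OF assms(2)] by blast
  then show ?thesis
    unfolding discontinuity_on_set_iff_wins game_iff_wins rank_discontinuity_iff_wins by simp
qed

end
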